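(* Let $\mathcal V\subset\mathfrak{sl}(N,\mathbb C)$ be a hypersurface orbital variety with $\sigma(\mathcal V)=\Pi$ and thickness $I=\mathrm{thick}(\sigma(\mathcal V))$. Let $\mathcal V_R$ be the Richardson orbital variety with $\tau(\mathcal V_R)=\tau(\mathcal V)$, let $\lambda$ be the shape of its tableau $T_R$, and set $l(\lambda):=\lambda_1+\cdots+\lambda_I-I$. If $\lambda_{I+1}=0$, then the non-linear generator $f$ of the ideal of $\overline{\mathcal V}$ is (up to a nonzero scalar) $$f=m_{l(\lambda)},$$ where $m_j$ denotes the coefficient of $t^{N-I-j}$ in $\det(\mathrm{cMin}_I(x_R+t\,\mathrm{id}))$.
   Context: Let $\mathfrak n$ be the strictly upper-triangular $N\times N$ complex matrices, with simple roots $\Pi=\{\alpha_1,\dots,\alpha_{N-1}\}$ and positive roots $R^+=\{\alpha(i,j)=\alpha_i+\cdots+\alpha_j : 1\le i\le j\le N-1\}$. The root vector $X_{\alpha(i,j)}$ spans the matrix position $(i,j+1)$, and $x_{i,j+1}$ is the corresponding coordinate. Identify $S(\mathfrak n)$ with $\mathbb C[x_{ij}: 1\le i<j\le N]$. For $\omega\subseteq\Pi$, $R^+(\omega)$ is the set of positive roots that are sums of elements of $\omega$. Orbital varieties: for a partition $\lambda$ of $N$, $\mathcal O_\lambda$ is the set of nilpotent matrices with Jordan blocks of sizes $\lambda_1,\lambda_2,\dots$. An orbital variety is an irreducible component of $\mathcal O_\lambda\cap\mathfrak n$ for some $\lambda$. Orbital varieties contained in $\mathcal O_\lambda$ are in bijection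 with standard Young tableaux of shape $\lambda$ (via the Robinson-Schensted correspondence). The tableau $T$ associated to $\mathcal V$ is the one in which, for each $k$, the boxes with entries $\le k$ form the Young diagram of the Jordan type of the upper-left $k\times k$ submatrix of a generic $x\in\mathcal V$. $\tau$-invariant: $\tau(\mathcal V)\subseteq\Pi$ is the set of simple roots $\alpha$ such that the subgroup generated by the root subgroups of $\pm\alpha$ stabilizes $\mathcal V$ under conjugation. Equivalently, $\alpha_i\in\tau(\mathcal V)$ iff $i$ lies in a strictly higher row than $i+1$ in $T$. For $\tau\subseteq\Pi$ let $\mathfrak m_\tau=\bigoplus_{\alpha\in R^+\setminus R^+(\tau)}\mathbb C X_\alpha$. The Richardson orbital variety with $\tau$-invariant $\tau$ is the unique orbital variety $\mathcal V_R$ with $\tau(\mathcal V_R)=\tau$ and $\overline{\mathcal V}_R=\mathfrak m_\tau$. A hypersurface orbital variety is an orbital variety $\mathcal V$ whose closure is a hypersurface (codimension one) in $\mathfrak m_{\tau(\mathcal V)}$. Non-linear generator: with $\tau=\tau(\mathcal V)$, the ideal of $\overline{\mathcal V}$ is generated by the coordinates $x_{st}$ with $\alpha(s,t-1)\in R^+(\tau)$ together with one irreducible homogeneous polynomial $f$ of degree $\ge2$ in the remaining coordinates, unique up to a nonzero scalar. $\sigma$-set: $\sigma(\mathcal V)$ is the smallest connected subset $\sigma$ of $\Pi$ (i.e. of the form $\{\alpha_a,\alpha_{a+1},\dots,\alpha_b\}$) such that $f\in S(\mathfrak n_\sigma)$, where $\mathfrak n_\sigma$ is the subalgebra of $\mathfrak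 n$ generated by the $X_\alpha$, $\alpha\in\sigma$. Chains of $T_R$: the orbits on $\{1,\dots,N\}$ of the group generated by the transpositions $(i\ i+1)$, $\alpha_i\in\tau$. They are intervals, numbered $C_1,\dots,C_{\lambda_1}$ in increasing order. The number of chains of length (cardinality) $i$ equals the number of columns of length $i$ in $T_R$. The tableau $T$ of $\mathcal V$ is obtained from $T_R$ by moving down one row the box of the largest element of some chain $C_t$ (other entries keep their rows), and $\mathrm{thick}(\sigma(\mathcal V)):=|C_t|$. When $\sigma(\mathcal V)=\Pi$, this moved box is $N$, $I=|C_1|=|C_{\lambda_1}|$, and $C_1,C_{\lambda_1}$ are the only chains of length $I$. Set $\lambda_m=0$ for $m$ larger than the number of rows. Generic matrix and minors: $x_R$ is the generic matrix of $\mathfrak m_\tau$, i.e. the strictly upper-triangular matrix with $(k,l)$ entry the independent variable $x_{kl}$ if $\alpha(k,l-1)\notin R^+(\tau)$ and $0$ otherwise. For an $N\times N$ matrix $y$, $\mathrm{cMin}_k(y)$ is the $(N-k)\times(N-k)$ submatrix in the top right corner of $y$ (rows $1,\dots,N-k$, columns $k+1,\dots,N$). Thus $\det(\mathrm{cMin}_I(x_R+t\,\mathrm{id}))=m_{N-I}+m_{N-I-1}t+\cdots+m_I t^{N-2I}$. *)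

theory Defs
  imports
    "Jordan_Normal_Form.Jordan_Normal_Form"
    "HOL-Library.Poly_Mapping"
    "HOL-Library.Extended_Nat"
    "HOL-Combinatorics.Transposition"
begin

text \<open>
  Matrix positions, coordinates, tableau entries and the parts of a partition are numbered from 1
  (\<open>entry\<close>, \<open>unit_matrix\<close>, \<open>cvar\<close>, \<open>part\<close>), whereas indexing of a \<open>mat\<close> or of
  the rows of a tableau starts from 0. The simple root
  \<open>\<alpha>\<^sub>i\<close> is represented by the number \<open>i\<close>, and the positive root
  \<open>\<alpha>(i,j) = \<alpha>\<^sub>i + \<dots> + \<alpha>\<^sub>j\<close> by the pair \<open>(i, j)\<close>.
\<close>

subsection \<open>Roots\<close>

definition simple_roots :: "nat \<Rightarrow> nat set" where
  "simple_roots N = {i. 1 \<le> i \<and> i < N}"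

definition pos_roots :: "nat \<Rightarrow> (nat \<times> nat) set" where
  "pos_roots N = {(i, j). 1 \<le> i \<and> i \<le> j \<and> j < N}"

text \<open>
  As the simple roots are linearly independent, \<open>\<alpha>(i,j)\<close> is a sum of elements of
  \<open>\<omega>\<close> exactly if its summands lie in \<open>\<omega>\<close>.
\<close>

definition pos_roots_of :: "nat \<Rightarrow> nat set \<Rightarrow> (nat \<times> nat) set" where
  "pos_roots_of N \<omega> = {(i, j) \<in> pos_roots N. {i..j} \<subseteq> \<omega>}"

definition connected_roots :: "nat \<Rightarrow> nat set \<Rightarrow> bool" where
  "connected_roots N \<sigma> \<longleftrightarrow> (\<exists>a b. 1 \<le> a \<and> a \<le> b \<and> b < N \<and> \<sigma> = {a..b})"


subsection \<open>Matrices\<close>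

definition entry :: "'a mat \<Rightarrow> nat \<times> nat \<Rightarrow> 'a" where
  "entry x = (\<lambda>(i, j). x $$ (i - 1, j - 1))"

definition unit_matrix :: "nat \<Rightarrow> nat \<Rightarrow> nat \<Rightarrow> complex mat" where
  "unit_matrix N i j = mat N N (\<lambda>(k, l). if Suc k = i \<and> Suc l = j then 1 else 0)"

definition strict_upper :: "nat \<Rightarrow> complex mat set" where
  "strict_upper N = {x \<in> carrier_mat N N. \<forall>i < N. \<forall>j \<le> i. x $$ (i, j) = 0}"

definition m_space :: "nat \<Rightarrow> nat set \<Rightarrow> complex mat set" where
  "m_space N \<tau> = {x \<in> strict_upper N. \<forall>(i, j) \<in> pos_roots_of N \<tau>. entry x (i, j + 1) = 0}"

inductive_set n_sub :: "nat \<Rightarrow> nat set \<Rightarrow> complex mat set" for N \<sigma> where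
  n_sub_gen: "i \<in> \<sigma> \<Longrightarrow> unit_matrix N i (i + 1) \<in> n_sub N \<sigma>"
| n_sub_zero: "0\<^sub>m N N \<in> n_sub N \<sigma>"
| n_sub_add: "x \<in> n_sub N \<sigma> \<Longrightarrow> y \<in> n_sub N \<sigma> \<Longrightarrow> x + y \<in> n_sub N \<sigma>"
| n_sub_smult: "x \<in> n_sub N \<sigma> \<Longrightarrow> c \<cdot>\<^sub>m x \<in> n_sub N \<sigma>"
| n_sub_bracket: "x \<in> n_sub N \<sigma> \<Longrightarrow> y \<in> n_sub N \<sigma> \<Longrightarrow> x * y - y * x \<in> n_sub N \<sigma>"

definition is_partition :: "nat \<Rightarrow> nat list \<Rightarrow> bool" where
  "is_partition N \<mu> \<longleftrightarrow> sorted_wrt (\<ge>) \<mu> \<and> 0 \<notin> set \<mu> \<and> sum_list \<mu> = N"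

definition part :: "nat list \<Rightarrow> nat \<Rightarrow> nat" where
  "part \<mu> i = (if 1 \<le> i \<and> i \<le> length \<mu> then \<mu> ! (i - 1) else 0)"

definition nilpotent_jordan_type :: "complex mat \<Rightarrow> nat list \<Rightarrow> bool" where
  "nilpotent_jordan_type x \<mu> \<longleftrightarrow> jordan_nf x (map (\<lambda>n. (n, 0)) \<mu>)"

definition nilpotent_orbit :: "nat \<Rightarrow> nat list \<Rightarrow> complex mat set" where
  "nilpotent_orbit N \<mu> = {x \<in> carrier_mat N N. nilpotent_jordan_type x \<mu>}"


subsection \<open>The polynomial ring $S(\mathfrak n)$\<close>

text \<open>
  Polynomials over the complex numbers in variables indexed by pairs of numbers, as finitely
  supported functions on monomials, which are finitely supported exponent functions.
\<close>

type_synonym cpoly = "((nat \<times> nat) \<Rightarrow>\<^sub>0 nat) \<Rightarrow>\<^sub>0 complex"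

definition cvar :: "nat \<times> nat \<Rightarrow> cpoly" where
  "cvar v = Poly_Mapping.single (Poly_Mapping.single v 1) 1"

definition cconst :: "complex \<Rightarrow> cpoly" where
  "cconst c = Poly_Mapping.single 0 c"

definition cvars :: "cpoly \<Rightarrow> (nat \<times> nat) set" where
  "cvars f = (\<Union>m \<in> Poly_Mapping.keys f. Poly_Mapping.keys m)"

definition homogeneous :: "nat \<Rightarrow> cpoly \<Rightarrow> bool" where
  "homogeneous d f \<longleftrightarrow> (\<forall>m \<in> Poly_Mapping.keys f.
     (\<Sum>v \<in> Poly_Mapping.keys m. Poly_Mapping.lookup m v) = d)"

definition ceval :: "complex mat \<Rightarrow> cpoly \<Rightarrow> complex" where
  "ceval x f = (\<Sum>m \<in> Poly_Mapping.keys f. Poly_Mapping.lookup f m *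
     (\<Prod>v \<in> Poly_Mapping.keys m. entry x v ^ Poly_Mapping.lookup m v))"

definition S_n :: "nat \<Rightarrow> cpoly set" where
  "S_n N = {f. cvars f \<subseteq> {(i, j). 1 \<le> i \<and> i < j \<and> j \<le> N}}"

text \<open>
  The inclusion of $S(\mathfrak n_\sigma)$ in $S(\mathfrak n)$ identifies it with the polynomials
  in those \<open>x\<^sub>i\<^sub>j\<close> whose root vector lies in $\mathfrak n_\sigma$.
\<close>

definition S_n_sub :: "nat \<Rightarrow> nat set \<Rightarrow> cpoly set" where
  "S_n_sub N \<sigma> = {f \<in> S_n N. \<forall>(i, j) \<in> cvars f. unit_matrix N i j \<in> n_sub N \<sigma>}"

definition ideal_generated :: "nat \<Rightarrow> cpoly set \<Rightarrow> cpoly set" where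
  "ideal_generated N A =
     {\<Sum>a\<in>F. c a * a | F c. finite F \<and> F \<subseteq> A \<and> (\<forall>a\<in>F. c a \<in> S_n N)}"


subsection \<open>The Zariski topology on $\mathfrak n$\<close>

definition zariski_closed :: "nat \<Rightarrow> complex mat set \<Rightarrow> bool" where
  "zariski_closed N Z \<longleftrightarrow>
     (\<exists>P \<subseteq> S_n N. Z = {x \<in> strict_upper N. \<forall>p \<in> P. ceval x p = 0})"

definition zariski_closure :: "nat \<Rightarrow> complex mat set \<Rightarrow> complex mat set" where
  "zariski_closure N A = \<Inter> {Z. zariski_closed N Z \<and> A \<subseteq> Z}"

definition irreducible_set :: "nat \<Rightarrow> complex mat set \<Rightarrow> bool" where
  "irreducible_set N A \<longleftrightarrow> A \<subseteq> strict_upper N \<and> A \<noteq> {} \<and>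
     (\<forall>Y Z. zariski_closed N Y \<and> zariski_closed N Z \<and> A \<subseteq> Y \<union> Z \<longrightarrow> A \<subseteq> Y \<or> A \<subseteq> Z)"

definition irreducible_component :: "nat \<Rightarrow> complex mat set \<Rightarrow> complex mat set \<Rightarrow> bool" where
  "irreducible_component N W A \<longleftrightarrow> A \<subseteq> W \<and> irreducible_set N A \<and>
     (\<forall>B. A \<subseteq> B \<and> B \<subseteq> W \<and> irreducible_set N B \<longrightarrow> B = A)"

text \<open>
  If there are no chains from \<open>Z\<close> to \<open>X\<close>, the supremum is 0; thus codimension
  1 implies that \<open>Z\<close> and \<open>X\<close> are irreducible closed sets with \<open>Z \<subset> X\<close>.
\<close>

definition zariski_codim :: "nat \<Rightarrow> complex mat set \<Rightarrow> complex mat set \<Rightarrow> enat" where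
  "zariski_codim N Z X = Sup {enat n | n. \<exists>C :: nat \<Rightarrow> complex mat set.
     C 0 = Z \<and> C n = X \<and> (\<forall>i \<le> n. zariski_closed N (C i) \<and> irreducible_set N (C i)) \<and>
     (\<forall>i < n. C i \<subset> C (Suc i))}"

definition generically :: "nat \<Rightarrow> complex mat set \<Rightarrow> (complex mat \<Rightarrow> bool) \<Rightarrow> bool" where
  "generically N A P \<longleftrightarrow> (\<exists>Z. zariski_closed N Z \<and> \<not> A \<subseteq> Z \<and> (\<forall>x \<in> A - Z. P x))"

definition vanishing_ideal :: "nat \<Rightarrow> complex mat set \<Rightarrow> cpoly set" where
  "vanishing_ideal N A = {p \<in> S_n N. \<forall>x \<in> A. ceval x p = 0}"


subsection \<open>Orbital varieties\<close>

definition orbital_variety :: "nat \<Rightarrow> complex mat set \<Rightarrow> bool" where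
  "orbital_variety N V \<longleftrightarrow> (\<exists>\<mu>. is_partition N \<mu> \<and>
     irreducible_component N (nilpotent_orbit N \<mu> \<inter> strict_upper N) V)"

text \<open>
  The subgroup generated by the root subgroups of \<open>\<alpha>\<^sub>i\<close> and
  \<open>- \<alpha>\<^sub>i\<close>; closure under inverses follows from that of the root subgroups.
\<close>

inductive_set simple_root_group :: "nat \<Rightarrow> nat \<Rightarrow> complex mat set" for N i where
  srg_one: "1\<^sub>m N \<in> simple_root_group N i"
| srg_pos: "g \<in> simple_root_group N i \<Longrightarrow>
    (1\<^sub>m N + c \<cdot>\<^sub>m unit_matrix N i (i + 1)) * g \<in> simple_root_group N i"
| srg_neg: "g \<in> simple_root_group N i \<Longrightarrow>
    (1\<^sub>m N + c \<cdot>\<^sub>m unit_matrix N (i + 1) i) * g \<in> simple_root_group N i"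

definition tau_invariant :: "nat \<Rightarrow> complex mat set \<Rightarrow> nat set" where
  "tau_invariant N V = {i \<in> simple_roots N. \<forall>g \<in> simple_root_group N i.
     \<forall>h \<in> carrier_mat N N. g * h = 1\<^sub>m N \<longrightarrow> (\<lambda>x. g * x * h) ` V = V}"

definition richardson_orbital_variety :: "nat \<Rightarrow> nat set \<Rightarrow> complex mat set \<Rightarrow> bool" where
  "richardson_orbital_variety N \<tau> V \<longleftrightarrow>
     orbital_variety N V \<and> tau_invariant N V = \<tau> \<and> zariski_closure N V = m_space N \<tau>"

definition hypersurface_orbital_variety :: "nat \<Rightarrow> complex mat set \<Rightarrow> bool" where
  "hypersurface_orbital_variety N V \<longleftrightarrow> orbital_variety N V \<and>
     zariski_codim N (zariski_closure N V) (m_space N (tau_invariant N V)) = 1"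

text \<open>
  Irreducibility refers to the ring of all \<open>cpoly\<close>; for an element of $S(\mathfrak n)$ it
  is the same as irreducibility in $S(\mathfrak n)$, since factors involve no further variables.
\<close>

definition nonlinear_generator :: "nat \<Rightarrow> complex mat set \<Rightarrow> cpoly \<Rightarrow> bool" where
  "nonlinear_generator N V f \<longleftrightarrow>
     (let R = pos_roots_of N (tau_invariant N V);
          linear = {cvar (s, t) | s t. (s, t - 1) \<in> R}
      in cvars f \<subseteq> {(s, t). (s, t - 1) \<in> pos_roots N - R} \<and>
         irreducible f \<and> (\<exists>d \<ge> 2. homogeneous d f) \<and>
         vanishing_ideal N (zariski_closure N V) = ideal_generated N (insert f linear))"

definition is_sigma_set :: "nat \<Rightarrow> complex mat set \<Rightarrow> nat set \<Rightarrow> bool" where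
  "is_sigma_set N V \<sigma> \<longleftrightarrow> (\<exists>f. nonlinear_generator N V f \<and>
     connected_roots N \<sigma> \<and> f \<in> S_n_sub N \<sigma> \<and>
     (\<forall>\<sigma>'. connected_roots N \<sigma>' \<and> f \<in> S_n_sub N \<sigma>' \<longrightarrow> \<sigma> \<subseteq> \<sigma>'))"


subsection \<open>Tableaux, chains and thickness\<close>

text \<open>A tableau is the list of its rows, from top to bottom.\<close>

definition shape :: "nat list list \<Rightarrow> nat list" where
  "shape T = map length T"

definition standard_tableau :: "nat \<Rightarrow> nat list list \<Rightarrow> bool" where
  "standard_tableau N T \<longleftrightarrow> is_partition N (shape T) \<and>
     distinct (concat T) \<and> set (concat T) = {1..N} \<and>
     (\<forall>r \<in> set T. sorted_wrt (<) r) \<and>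
     (\<forall>i j. Suc i < length T \<and> j < length (T ! Suc i) \<longrightarrow> T ! i ! j < T ! Suc i ! j)"

definition restrict_tableau :: "nat \<Rightarrow> nat list list \<Rightarrow> nat list list" where
  "restrict_tableau k T = filter (\<lambda>r. r \<noteq> []) (map (filter (\<lambda>a. a \<le> k)) T)"

definition row_of :: "nat list list \<Rightarrow> nat \<Rightarrow> nat" where
  "row_of T a = (THE r. r < length T \<and> a \<in> set (T ! r))"

definition associated_tableau :: "nat \<Rightarrow> complex mat set \<Rightarrow> nat list list \<Rightarrow> bool" where
  "associated_tableau N V T \<longleftrightarrow> standard_tableau N T \<and>
     (\<forall>k \<in> {1..N}. generically N V (\<lambda>x.
        nilpotent_jordan_type (mat k k (\<lambda>(i, j). x $$ (i, j))) (shape (restrict_tableau k T))))"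

inductive_set transposition_group :: "nat set \<Rightarrow> (nat \<Rightarrow> nat) set" for \<tau> where
  tg_id: "id \<in> transposition_group \<tau>"
| tg_step: "p \<in> transposition_group \<tau> \<Longrightarrow> i \<in> \<tau> \<Longrightarrow>
    Transposition.transpose i (i + 1) \<circ> p \<in> transposition_group \<tau>"

definition chains :: "nat \<Rightarrow> nat set \<Rightarrow> nat set set" where
  "chains N \<tau> = (\<lambda>a. (\<lambda>p. p a) ` transposition_group \<tau>) ` {1..N}"

definition is_thickness :: "nat \<Rightarrow> complex mat set \<Rightarrow> nat \<Rightarrow> bool" where
  "is_thickness N V I \<longleftrightarrow> (\<exists>VR TR T C.
     richardson_orbital_variety N (tau_invariant N V) VR \<and>
     associated_tableau N VR TR \<and> associated_tableau N V T \<and>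
     C \<in> chains N (tau_invariant N V) \<and>
     (\<forall>a \<in> {1..N}. row_of T a = (if a = Max C then row_of TR a + 1 else row_of TR a)) \<and>
     I = card C)"


subsection \<open>Generic matrices and minors\<close>

definition generic_matrix :: "nat \<Rightarrow> nat set \<Rightarrow> cpoly mat" where
  "generic_matrix N \<tau> = mat N N (\<lambda>(i, j).
     let k = Suc i; l = Suc j in
     if k < l \<and> (k, l - 1) \<notin> pos_roots_of N \<tau> then cvar (k, l) else 0)"

definition cMin :: "nat \<Rightarrow> 'a mat \<Rightarrow> 'a mat" where
  "cMin k y = mat (dim_row y - k) (dim_col y - k) (\<lambda>(i, j). y $$ (i, j + k))"

text \<open>The determinant is a polynomial in \<open>t\<close> with coefficients in the polynomial ring.\<close>

definition minor_poly :: "nat \<Rightarrow> nat set \<Rightarrow> nat \<Rightarrow> cpoly poly" where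
  "minor_poly N \<tau> I =
     det (cMin I (map_mat (\<lambda>a. [:a:]) (generic_matrix N \<tau>) + [:0, 1:] \<cdot>\<^sub>m 1\<^sub>m N))"

definition minor_coeff :: "nat \<Rightarrow> nat set \<Rightarrow> nat \<Rightarrow> nat \<Rightarrow> cpoly" where
  "minor_coeff N \<tau> I j = coeff (minor_poly N \<tau> I) (N - I - j)"

text \<open>
  The subtraction does not truncate in the case of interest: if the \<open>(I + 1)\<close>-th part is 0, then
  the sum is the size of the partition.
\<close>

definition l_number :: "nat list \<Rightarrow> nat \<Rightarrow> nat" where
  "l_number \<mu> I = (\<Sum>i = 1..I. part \<mu> i) - I"

end

theory Submission
  imports Defs "HOL-Library.Product_Lexorder" "Jordan_Normal_Form.DL_Rank"
    "Jordan_Normal_Form.Jordan_Normal_Form_Uniqueness"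
begin

text \<open>
  If \<open>\<lambda>\<^sub>I\<^sub>+\<^sub>1 = 0\<close>, then \<open>l(\<lambda>) = N - I\<close>, so the claim is that the generator is the determinant \<open>D\<close>
  of the top right \<open>(N - I) \<times> (N - I)\<close> block of the generic matrix. For \<open>x\<close> in \<open>m_space\<close> and a chain
  \<open>{b<..a}\<close>, \<open>x\<close> maps the first \<open>a\<close> unit vectors into the span of the first \<open>b\<close>, so the boxes of the
  chain lie in distinct rows of every tableau of such matrices. As \<open>T\<^sub>R\<close> has at most \<open>I\<close> rows, the
  chain of length \<open>I\<close> fills them all, and moving down its largest element \<open>a\<close> creates a new row. The
  kernel of the upper left \<open>a \<times> a\<close> block therefore has dimension more than \<open>I\<close> on \<open>V\<close>, so the
  corresponding minor vanishes on \<open>V\<close> and is a multiple of the generator. The generator involves the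
  last column and the first row, as its \<open>\<sigma>\<close>-set is full. The former forces \<open>a = N\<close>. Moreover, another
  chain of length \<open>I\<close> away from the upper left corner would split \<open>D\<close> into two blocks,
  one of which vanishes on the irreducible set \<open>V\<close> without involving both. Thus the diagonal and
  subdiagonal entries of the block are variables, and, as \<open>D\<close> has degree at most one in each row and each
  column, this forces any cofactor of the generator in \<open>D\<close> to be constant.
\<close>

subsection \<open>Substitutions and degrees of polynomials\<close>

definition monom_eval :: "('v \<Rightarrow> 'b::comm_ring_1) \<Rightarrow> ('v \<Rightarrow>\<^sub>0 nat) \<Rightarrow> 'b" where
  "monom_eval h m = (\<Prod>v \<in> Poly_Mapping.keys m. h v ^ Poly_Mapping.lookup m v)"

text \<open>One substitution homomorphism with a free choice of target ring serves for evaluation at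
  a matrix, for setting variables to zero and for the grading by a parameter.\<close>

definition psub :: "(complex \<Rightarrow> 'b) \<Rightarrow> (nat \<times> nat \<Rightarrow> 'b::comm_ring_1) \<Rightarrow> cpoly \<Rightarrow> 'b" where
  "psub k h f = (\<Sum>m \<in> Poly_Mapping.keys f. k (Poly_Mapping.lookup f m) * monom_eval h m)"

lemma monom_eval_superset:
  assumes "finite A" "Poly_Mapping.keys m \<subseteq> A"
  shows "monom_eval h m = (\<Prod>v \<in> A. h v ^ Poly_Mapping.lookup m v)"
  unfolding monom_eval_def
  by (rule prod.mono_neutral_left) (use assms in \<open>auto simp: in_keys_iff\<close>)

lemma monom_eval_0 [simp]: "monom_eval h 0 = 1"
  by (simp add: monom_eval_def)

lemma monom_eval_add: "monom_eval h (m + n) = monom_eval h m * monom_eval h n"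
proof -
  let ?A = "Poly_Mapping.keys m \<union> Poly_Mapping.keys n"
  have fin: "finite ?A" by simp
  have sub: "Poly_Mapping.keys (m + n) \<subseteq> ?A"
    by (rule Poly_Mapping.keys_add)
  show ?thesis
    unfolding monom_eval_superset[OF fin sub] monom_eval_superset[OF fin Un_upper1]
      monom_eval_superset[OF fin Un_upper2]
    by (simp add: lookup_add power_add prod.distrib)
qed

lemma monom_eval_single [simp]: "monom_eval h (Poly_Mapping.single v 1) = h v"
  by (simp add: monom_eval_def)

lemma poly_mapping_sum_single:
  "(f :: 'a \<Rightarrow>\<^sub>0 'b::comm_monoid_add)
    = (\<Sum>m \<in> Poly_Mapping.keys f. Poly_Mapping.single m (Poly_Mapping.lookup f m))"
  by (rule poly_mapping_eqI) (auto simp: lookup_sum lookup_single when_def in_keys_iff)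

context
  fixes k :: "complex \<Rightarrow> 'b::comm_ring_1"
  assumes k: "comm_ring_hom k"
begin

interpretation comm_ring_hom k by (rule k)

lemma psub_superset:
  assumes "finite A" "Poly_Mapping.keys f \<subseteq> A"
  shows "psub k h f = (\<Sum>m \<in> A. k (Poly_Mapping.lookup f m) * monom_eval h m)"
  unfolding psub_def
  by (rule sum.mono_neutral_left) (use assms in \<open>auto simp: in_keys_iff\<close>)

lemma psub_add: "psub k h (f + g) = psub k h f + psub k h g"
proof -
  let ?A = "Poly_Mapping.keys f \<union> Poly_Mapping.keys g"
  have fin: "finite ?A" by simp
  have sub: "Poly_Mapping.keys (f + g) \<subseteq> ?A"
    by (rule Poly_Mapping.keys_add)
  show ?thesis
    unfolding psub_superset[OF fin sub] psub_superset[OF fin Un_upper1]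
      psub_superset[OF fin Un_upper2]
    by (simp add: lookup_add hom_add distrib_right sum.distrib)
qed

lemma psub_0 [simp]: "psub k h 0 = 0"
  by (simp add: psub_def)

lemma psub_single: "psub k h (Poly_Mapping.single m c) = k c * monom_eval h m"
  by (cases "c = 0") (simp_all add: psub_def)

lemma psub_sum: "psub k h (sum F A) = (\<Sum>a\<in>A. psub k h (F a))"
  by (induction A rule: infinite_finite_induct) (simp_all add: psub_add)

lemma psub_mult: "psub k h (f * g) = psub k h f * psub k h g"
proof -
  have "f * g = (\<Sum>m \<in> Poly_Mapping.keys f. \<Sum>n \<in> Poly_Mapping.keys g.
      Poly_Mapping.single (m + n) (Poly_Mapping.lookup f m * Poly_Mapping.lookup g n))"
    by (subst poly_mapping_sum_single[of f], subst poly_mapping_sum_single[of g])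
      (simp add: sum_product mult_single)
  then have "psub k h (f * g) = (\<Sum>m \<in> Poly_Mapping.keys f. \<Sum>n \<in> Poly_Mapping.keys g.
      k (Poly_Mapping.lookup f m) * monom_eval h m * (k (Poly_Mapping.lookup g n) * monom_eval h n))"
    by (simp add: psub_sum psub_single monom_eval_add hom_mult mult_ac)
  then show ?thesis
    by (simp add: psub_def sum_product)
qed

lemma comm_ring_hom_psub: "comm_ring_hom (psub k h)"
proof
  show "psub k h 1 = 1"
    by (simp flip: single_one add: psub_single)
qed (simp_all add: psub_add psub_mult)

lemma psub_cvar [simp]: "psub k h (cvar v) = h v"
  unfolding cvar_def psub_single monom_eval_single by simp

lemma psub_cconst [simp]: "psub k h (cconst c) = k c"
  by (simp add: cconst_def psub_single)

lemma hom_psub: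
  assumes "comm_ring_hom F"
  shows "F (psub k h f) = psub (\<lambda>c. F (k c)) (\<lambda>v. F (h v)) f"
proof -
  interpret F: comm_ring_hom F by (rule assms)
  show ?thesis
    by (simp add: psub_def monom_eval_def hom_distribs)
qed

end

lemma psub_cong: "(\<And>v. v \<in> cvars f \<Longrightarrow> h v = h' v) \<Longrightarrow> psub k h f = psub k h' f"
  unfolding psub_def monom_eval_def cvars_def
  by (intro sum.cong prod.cong arg_cong2[where f="(*)"] arg_cong2[where f="(^)"] refl) blast

lemma comm_ring_hom_cconst: "comm_ring_hom cconst"
  by standard (auto simp: cconst_def single_add mult_single single_one)

lemma cconst_1 [simp]: "cconst 1 = 1"
  by (simp add: cconst_def single_one)

lemma cconst_eq_0_iff [simp]: "cconst c = 0 \<longleftrightarrow> c = 0"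
  unfolding cconst_def by (metis lookup_single_eq lookup_zero single_zero)

lemma comm_ring_hom_cconst_poly: "comm_ring_hom (\<lambda>c. [:cconst c:])"
proof -
  interpret comm_ring_hom cconst by (rule comm_ring_hom_cconst)
  show ?thesis by standard (auto simp: hom_distribs one_pCons)
qed

lemma monom_eval_cvar: "monom_eval cvar m = Poly_Mapping.single m 1"
proof -
  have *: "cvar v ^ n = Poly_Mapping.single (Poly_Mapping.single v n) 1" for v n
    by (induction n) (simp_all add: cvar_def mult_single flip: single_add)
  have "(\<Prod>v\<in>A. Poly_Mapping.single (Poly_Mapping.single v (Poly_Mapping.lookup m v)) (1::complex))
      = Poly_Mapping.single (\<Sum>v\<in>A. Poly_Mapping.single v (Poly_Mapping.lookup m v)) 1"
    if "finite A" for A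
    using that by induction (simp_all add: mult_single)
  then show ?thesis
    unfolding monom_eval_def * by (simp flip: poly_mapping_sum_single)
qed

lemma psub_id: "psub cconst cvar f = f"
  unfolding psub_def monom_eval_cvar
  by (subst (3) poly_mapping_sum_single[of f]) (simp add: cconst_def mult_single)

lemma ceval_psub: "ceval x = psub (\<lambda>c. c) (entry x)"
  by (auto simp: ceval_def psub_def monom_eval_def fun_eq_iff)

lemma comm_ring_hom_ident: "comm_ring_hom (\<lambda>c :: complex. c)"
  by standard auto

lemma comm_ring_hom_ceval: "comm_ring_hom (ceval x)"
  unfolding ceval_psub by (rule comm_ring_hom_psub[OF comm_ring_hom_ident])

lemma ceval_cvar [simp]: "ceval x (cvar v) = entry x v"
  unfolding ceval_psub by (simp add: psub_cvar[OF comm_ring_hom_ident])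

lemma ceval_cconst [simp]: "ceval x (cconst c) = c"
  unfolding ceval_psub by (simp add: psub_cconst[OF comm_ring_hom_ident])

lemma ceval_cong:
  "(\<And>v. v \<in> cvars f \<Longrightarrow> entry x v = entry y v) \<Longrightarrow> ceval x f = ceval y f"
  unfolding ceval_psub by (rule psub_cong)

section \<open>Variables occurring in a polynomial\<close>

definition restrict_vars :: "(nat \<times> nat) set \<Rightarrow> cpoly \<Rightarrow> cpoly" where
  "restrict_vars W = psub cconst (\<lambda>v. if v \<in> W then cvar v else 0)"

lemma comm_ring_hom_restrict_vars: "comm_ring_hom (restrict_vars W)"
  unfolding restrict_vars_def by (rule comm_ring_hom_psub[OF comm_ring_hom_cconst])

lemma restrict_vars_cvar [simp]: "restrict_vars W (cvar v) = (if v \<in> W then cvar v else 0)"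
  unfolding restrict_vars_def by (simp add: psub_cvar[OF comm_ring_hom_cconst])

lemma cvars_add: "cvars (f + g) \<subseteq> cvars f \<union> cvars g"
  unfolding cvars_def using Poly_Mapping.keys_add[of f g] by blast

lemma cvars_sum: "cvars (sum F A) \<subseteq> (\<Union>a\<in>A. cvars (F a))"
proof (induction A rule: infinite_finite_induct)
  case (insert x A)
  then show ?case using cvars_add[of "F x" "sum F A"] by auto
qed (auto simp: cvars_def)

lemma restrict_vars_ident:
  assumes "cvars f \<subseteq> W"
  shows "restrict_vars W f = f"
proof -
  have "restrict_vars W f = psub cconst cvar f"
    unfolding restrict_vars_def by (rule psub_cong) (use assms in auto)
  then show ?thesis by (simp add: psub_id)
qed

lemma cvars_restrict_vars: "cvars (restrict_vars W f) \<subseteq> W"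
proof -
  \<comment> \<open>A monomial either has all its variables in \<open>W\<close> and is fixed, or is
    killed by a factor 0.\<close>
  have "cvars (cconst c * monom_eval (\<lambda>v. if v \<in> W then cvar v else 0) m) \<subseteq> W" for c m
  proof (cases "Poly_Mapping.keys m \<subseteq> W")
    case True
    then have "monom_eval (\<lambda>v. if v \<in> W then cvar v else 0) m = monom_eval cvar m"
      unfolding monom_eval_def by (intro prod.cong) auto
    then show ?thesis using True
      by (auto simp: monom_eval_cvar cconst_def mult_single cvars_def)
  next
    case False
    then have "monom_eval (\<lambda>v. if v \<in> W then cvar v else 0) m = 0"
      by (auto simp: monom_eval_def in_keys_iff)
    then show ?thesis by (simp add: cvars_def)
  qed
  then show ?thesis
    unfolding restrict_vars_def psub_def using cvars_sum by blast
qed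

text \<open>A bound on the variables becomes the property of being fixed by a ring homomorphism,
  which passes through determinants.\<close>

lemma restrict_vars_eq_iff: "restrict_vars W f = f \<longleftrightarrow> cvars f \<subseteq> W"
  using restrict_vars_ident cvars_restrict_vars by metis

text \<open>Scaling the variables in \<open>W\<close> by \<open>t\<close> makes the degree in \<open>W\<close> an
  additive degree of polynomials in \<open>t\<close>.\<close>

definition scale_vars :: "(nat \<times> nat) set \<Rightarrow> cpoly \<Rightarrow> cpoly poly" where
  "scale_vars W = psub (\<lambda>c. [:cconst c:]) (\<lambda>v. if v \<in> W then [:0, cvar v:] else [:cvar v:])"

lemma comm_ring_hom_scale_vars: "comm_ring_hom (scale_vars W)"
  unfolding scale_vars_def by (rule comm_ring_hom_psub[OF comm_ring_hom_cconst_poly])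

lemma scale_vars_cvar [simp]:
  "scale_vars W (cvar v) = (if v \<in> W then [:0, cvar v:] else [:cvar v:])"
  unfolding scale_vars_def by (simp add: psub_cvar[OF comm_ring_hom_cconst_poly])

lemma comm_ring_hom_poly: "comm_ring_hom (\<lambda>p. poly p (a::'a::comm_ring_1))"
  by standard auto

lemma poly_scale_vars_1: "poly (scale_vars W f) 1 = f"
proof -
  have "poly (scale_vars W f) 1 = psub cconst cvar f"
    unfolding scale_vars_def hom_psub[OF comm_ring_hom_cconst_poly comm_ring_hom_poly]
    by (rule arg_cong2[where f="\<lambda>a b. psub a b f"]) auto
  then show ?thesis by (simp add: psub_id)
qed

lemma poly_scale_vars_0: "poly (scale_vars W f) 0 = restrict_vars (- W) f"
  unfolding scale_vars_def hom_psub[OF comm_ring_hom_cconst_poly comm_ring_hom_poly]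
    restrict_vars_def
  by (rule arg_cong2[where f="\<lambda>a b. psub a b f"]) auto

lemma scale_vars_eq_0_iff [simp]: "scale_vars W f = 0 \<longleftrightarrow> f = 0"
proof -
  interpret comm_ring_hom "scale_vars W" by (rule comm_ring_hom_scale_vars)
  show ?thesis using poly_scale_vars_1[of W f] by auto
qed

text \<open>Evaluation of the parameter at 1 gives back \<open>f\<close>, evaluation at 0 deletes
  the variables in \<open>W\<close>, and a constant polynomial has the same value at both.\<close>

lemma degree_scale_vars_eq_0_iff: "degree (scale_vars W f) = 0 \<longleftrightarrow> cvars f \<inter> W = {}"
proof
  assume "degree (scale_vars W f) = 0"
  then obtain c where c: "scale_vars W f = [:c:]" by (rule degree_eq_zeroE)
  then have "restrict_vars (- W) f = f"
    using poly_scale_vars_0[of W f] poly_scale_vars_1[of W f] by simp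
  then show "cvars f \<inter> W = {}" by (auto simp: restrict_vars_eq_iff)
next
  assume "cvars f \<inter> W = {}"
  then have "scale_vars W f = psub (\<lambda>c. [:cconst c:]) (\<lambda>v. [:cvar v:]) f"
    unfolding scale_vars_def by (intro psub_cong) auto
  also have "\<dots> = [:psub cconst cvar f:]"
  proof -
    have "comm_ring_hom (\<lambda>a :: cpoly. [:a:])" by standard (auto simp: one_pCons)
    from hom_psub[OF comm_ring_hom_cconst this] show ?thesis by simp
  qed
  finally show "degree (scale_vars W f) = 0" by simp
qed

lemma degree_scale_vars_mult:
  "f \<noteq> 0 \<Longrightarrow> g \<noteq> 0 \<Longrightarrow>
    degree (scale_vars W (f * g)) = degree (scale_vars W f) + degree (scale_vars W g)"
proof -
  interpret comm_ring_hom "scale_vars W" by (rule comm_ring_hom_scale_vars)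
  assume "f \<noteq> 0" "g \<noteq> 0"
  then show ?thesis by (simp add: hom_mult degree_mult_eq)
qed

text \<open>No variable can cancel out of a product, because the degree in a single variable is
  additive over an integral domain.\<close>

lemma cvars_mult:
  assumes "f \<noteq> 0" "g \<noteq> 0"
  shows "cvars (f * g) = cvars f \<union> cvars g"
proof -
  have "v \<in> cvars (f * g) \<longleftrightarrow> v \<in> cvars f \<union> cvars g" for v
    using degree_scale_vars_mult[OF assms, of "{v}"]
      degree_scale_vars_eq_0_iff[of "{v}" "f * g"] degree_scale_vars_eq_0_iff[of "{v}" f]
      degree_scale_vars_eq_0_iff[of "{v}" g]
    by auto
  then show ?thesis by blast
qed

lemma cvars_empty_imp_cconst:
  assumes "cvars f = {}"
  obtains c where "f = cconst c"
proof -
  have "m = 0" if "m \<in> Poly_Mapping.keys f" for m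
    using assms that by (auto simp: cvars_def)
  then have "Poly_Mapping.keys f \<subseteq> {0}" by auto
  then have "f = cconst (Poly_Mapping.lookup f 0)"
    unfolding cconst_def by (intro poly_mapping_eqI) (auto simp: lookup_single when_def in_keys_iff)
  then show ?thesis by (rule that)
qed

lemma unit_imp_cconst:
  assumes "f * g = (1 :: cpoly)"
  obtains c where "c \<noteq> 0" "f = cconst c"
proof -
  have nz: "f \<noteq> 0" "g \<noteq> 0" using assms by auto
  have "cvars (1 :: cpoly) = {}" by (simp add: cvars_def flip: single_one)
  then have "cvars f = {}" using cvars_mult[OF nz] assms by simp
  then show ?thesis using nz cvars_empty_imp_cconst that cconst_eq_0_iff by metis
qed

lemma cconst_dvd_1: "c \<noteq> 0 \<Longrightarrow> cconst c dvd 1"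
  by (rule dvdI[of _ _ "cconst (1 / c)"]) (simp add: cconst_def mult_single single_one)

lemma keys_cconst_mult:
  assumes "c \<noteq> 0"
  shows "Poly_Mapping.keys (cconst c * f) = Poly_Mapping.keys f"
proof -
  have "cconst c * f = (\<Sum>m \<in> Poly_Mapping.keys f. Poly_Mapping.single m (c * Poly_Mapping.lookup f m))"
    by (subst poly_mapping_sum_single[of f]) (simp add: cconst_def sum_distrib_left mult_single)
  then have "Poly_Mapping.lookup (cconst c * f) m = c * Poly_Mapping.lookup f m" for m
    by (auto simp: lookup_sum lookup_single when_def in_keys_iff)
  then show ?thesis using assms by (auto simp: in_keys_iff)
qed

lemma cvars_det:
  assumes "\<And>i j. i < n \<Longrightarrow> j < n \<Longrightarrow> cvars (A (i, j)) \<subseteq> W"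
  shows "cvars (det (mat n n A)) \<subseteq> W"
proof -
  interpret comm_ring_hom "restrict_vars W" by (rule comm_ring_hom_restrict_vars)
  have "map_mat (restrict_vars W) (mat n n A) = mat n n A"
    using assms by (intro eq_matI) (auto simp: restrict_vars_ident)
  then have "restrict_vars W (det (mat n n A)) = det (mat n n A)"
    by (metis hom_det)
  then show ?thesis by (simp add: restrict_vars_eq_iff)
qed

lemma ceval_det:
  "ceval x (det (mat n n A)) = det (mat n n (\<lambda>ij. ceval x (A ij)))"
proof -
  interpret comm_ring_hom "ceval x" by (rule comm_ring_hom_ceval)
  have "map_mat (ceval x) (mat n n A) = mat n n (\<lambda>ij. ceval x (A ij))"
    by (intro eq_matI) auto
  then show ?thesis by (metis hom_det)
qed

subsection \<open>Kernel dimensions\<close>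

lemma sum_if_eq_mult:
  "(\<Sum>k = 0..<n::nat. (if i = k then 1 else 0) * f k) = (if i < n then f i else 0 :: 'a::semiring_1)"
proof -
  have "(\<Sum>k = 0..<n. (if i = k then 1 else 0) * f k) = (\<Sum>k = 0..<n. if i = k then f k else 0)"
    by (rule sum.cong) auto
  then show ?thesis by simp
qed

lemma linear_map_mat_kernel:
  fixes A C :: "'a::field mat"
  assumes A: "A \<in> carrier_mat nr n" and C: "C \<in> carrier_mat m n"
  shows "linear_map class_ring ((module_vec TYPE('a) n)\<lparr>carrier := mat_kernel A\<rparr>)
    (module_vec TYPE('a) m) ((*\<^sub>v) C)"
proof -
  interpret K: kernel nr n A by (unfold_locales, rule A)
  interpret W: vec_space "TYPE('a)" m .
  have "v \<in> carrier_vec n" if "v \<in> mat_kernel A" for v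
    using mat_kernelD[OF A that] by simp
  then have "(*\<^sub>v) C \<in> module_hom class_ring K.VK (module_vec TYPE('a) m)"
    using C by (simp add: module_hom_def module_vec_def mult_add_distrib_mat_vec[OF C]
        mult_mat_vec[OF C] Pi_iff)
  then show ?thesis
    by (rule linear_map.intro[OF K.Ker.vectorspace_axioms W.vectorspace_axioms
          mod_hom.intro[OF K.Ker.module_axioms W.module_axioms mod_hom_axioms.intro]])
qed

lemma fin_dim_mat_kernel:
  fixes A :: "'a::field mat"
  assumes A: "A \<in> carrier_mat nr n"
  shows "vectorspace.fin_dim class_ring ((module_vec TYPE('a) n)\<lparr>carrier := mat_kernel A\<rparr>)"
proof -
  interpret K: kernel nr n A by (unfold_locales, rule A)
  obtain B where "finite B" "K.basis B" using kernel_basis_exists[OF A] by blast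
  then show ?thesis unfolding K.Ker.fin_dim_def K.Ker.basis_def by blast
qed

text \<open>Rank-nullity for the restriction of \<open>C\<close> to the kernel of \<open>A\<close>.
  The last two conclusions allow such images to be compared as nested subspaces of one
  space.\<close>

lemma kernel_dim_mult:
  fixes A A' C :: "'a::field mat"
  assumes A: "A \<in> carrier_mat nr n" and C: "C \<in> carrier_mat m n" and A': "A' \<in> carrier_mat nr' n"
    and ker: "mat_kernel A' = {v \<in> mat_kernel A. C *\<^sub>v v = 0\<^sub>v m}"
  defines "im \<equiv> (*\<^sub>v) C ` mat_kernel A"
  defines "W \<equiv> module_vec TYPE('a) m"
  shows "vectorspace.dim class_ring (W\<lparr>carrier := im\<rparr>) + kernel_dim A' = kernel_dim A"
    and "VectorSpace.subspace class_ring im W"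
    and "vectorspace.fin_dim class_ring (W\<lparr>carrier := im\<rparr>)"
proof -
  interpret K: kernel nr n A by (unfold_locales, rule A)
  interpret K': kernel nr' n A' by (unfold_locales, rule A')
  interpret W: vec_space "TYPE('a)" m .
  interpret L: linear_map class_ring K.VK W "(*\<^sub>v) C"
    unfolding W_def by (rule linear_map_mat_kernel[OF A C])
  have fin: "K.Ker.fin_dim" by (rule fin_dim_mat_kernel[OF A])
  have im: "L.imT = im" by (simp add: L.im_def im_def)
  have kr: "L.kerT = mat_kernel A'" unfolding L.ker_def by (simp add: ker W_def module_vec_def)
  show "vectorspace.dim class_ring (W\<lparr>carrier := im\<rparr>) + kernel_dim A' = kernel_dim A"
    using L.rank_nullity[OF fin] unfolding im kr by simp
  show sub: "VectorSpace.subspace class_ring im W"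
    using L.imT_is_subspace im by simp
  have "linear_map class_ring K.VK (W\<lparr>carrier := im\<rparr>) ((*\<^sub>v) C)"
  proof (intro linear_map.intro mod_hom.intro mod_hom_axioms.intro)
    show vs: "vectorspace class_ring (W\<lparr>carrier := im\<rparr>)"
      using W.subspace_is_vs sub unfolding W_def by blast
    then show "module class_ring (W\<lparr>carrier := im\<rparr>)"
      by (simp add: vectorspace_def)
    show "(*\<^sub>v) C \<in> module_hom class_ring K.VK (W\<lparr>carrier := im\<rparr>)"
      using L.f_hom by (auto simp: module_hom_def im_def)
  qed (rule K.Ker.vectorspace_axioms K.Ker.module_axioms)+
  from linear_map.rank_nullity_main(2)[OF this fin]
  show "vectorspace.fin_dim class_ring (W\<lparr>carrier := im\<rparr>)"
    by (simp add: im_def)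
qed

text \<open>\<open>M\<close> induces an injection of \<open>ker A / ker A'\<close> into
  \<open>ker B / ker B'\<close>. Applying \<open>B'\<close> realises the quotients as the images
  \<open>B' M (ker A)\<close> and \<open>B' (ker B)\<close>, the first of which is contained in the
  second.\<close>

lemma kernel_dim_quotient_mono:
  fixes A A' B B' M :: "'a::field mat"
  assumes A: "A \<in> carrier_mat nr n" and A': "A' \<in> carrier_mat nr' n"
    and B: "B \<in> carrier_mat mr m" and B': "B' \<in> carrier_mat mr' m" and M: "M \<in> carrier_mat m n"
    and sub: "mat_kernel B' \<subseteq> mat_kernel B"
    and into: "\<And>v. v \<in> mat_kernel A \<Longrightarrow> M *\<^sub>v v \<in> mat_kernel B"
    and ker: "mat_kernel A' = {v \<in> mat_kernel A. M *\<^sub>v v \<in> mat_kernel B'}"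
  shows "kernel_dim A + kernel_dim B' \<le> kernel_dim A' + kernel_dim B"
proof -
  let ?W = "module_vec TYPE('a) mr'"
  let ?im1 = "(*\<^sub>v) (B' * M) ` mat_kernel A" and ?im2 = "(*\<^sub>v) B' ` mat_kernel B"
  have assoc: "(B' * M) *\<^sub>v v = B' *\<^sub>v (M *\<^sub>v v)" if "v \<in> mat_kernel A" for v
    using mat_kernelD(1)[OF A that] B' M by (simp add: assoc_mult_mat_vec)
  have BM: "B' * M \<in> carrier_mat mr' n" using B' M by simp
  have ker1: "mat_kernel A' = {v \<in> mat_kernel A. (B' * M) *\<^sub>v v = 0\<^sub>v mr'}"
    unfolding ker using assoc into mat_kernelD[OF B] mat_kernel[OF B'] by auto
  have ker2: "mat_kernel B' = {v \<in> mat_kernel B. B' *\<^sub>v v = 0\<^sub>v mr'}"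
    using sub mat_kernelD[OF B] mat_kernel[OF B'] by auto
  note 1 = kernel_dim_mult[OF A BM A' ker1] and 2 = kernel_dim_mult[OF B B' B' ker2]
  have im: "?im1 \<subseteq> ?im2" using assoc into by auto
  interpret W: vec_space "TYPE('a)" mr' .
  have "vectorspace class_ring (?W\<lparr>carrier := ?im2\<rparr>)"
    using W.subspace_is_vs 2(2) by blast
  from vectorspace.subspace_dim[OF this W.nested_subspaces[OF 2(2) 1(2) im] 2(3)]
  have "vectorspace.dim class_ring (?W\<lparr>carrier := ?im1\<rparr>) \<le> vectorspace.dim class_ring (?W\<lparr>carrier := ?im2\<rparr>)"
    using 1(3) by simp
  then show ?thesis using 1(1) 2(1) by linarith
qed

lemma kernel_dim_1: "kernel_dim (1\<^sub>m n :: 'a::field mat) = 0"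
proof -
  interpret kernel n n "1\<^sub>m n" by unfold_locales simp
  show ?thesis using kernel_one_mat(1)[where 'a='a, of n] kernel_dim by simp
qed

lemma kernel_dim_0: "kernel_dim (0\<^sub>m nr n :: 'a::field mat) \<le> n"
  unfolding kernel_dim_code by simp

text \<open>If the top right block is invertible, a kernel vector is determined by its first
  \<open>I\<close> coordinates.\<close>

lemma kernel_dim_le_of_minor:
  fixes y :: "'a::field mat"
  assumes y: "y \<in> carrier_mat a a" and I: "I \<le> a"
    and det: "det (mat (a - I) (a - I) (\<lambda>(i, j). y $$ (i, I + j))) \<noteq> 0"
  shows "kernel_dim y \<le> I"
proof -
  \<comment> \<open>\<open>?M\<close> reads off the first \<open>I\<close> coordinates.\<close>
  let ?M = "mat I a (\<lambda>(i, j). if i = j then 1 else 0 :: 'a)"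
  let ?D = "mat (a - I) (a - I) (\<lambda>(i, j). y $$ (i, I + j))"
  have inj: "v = 0\<^sub>v a" if v: "v \<in> mat_kernel y" "?M *\<^sub>v v = 0\<^sub>v I" for v
  proof -
    have vc: "v \<in> carrier_vec a" and yv: "y *\<^sub>v v = 0\<^sub>v a" using mat_kernelD[OF y v(1)] by auto
    have v0: "v $ i = 0" if "i < I" for i
    proof -
      have "(?M *\<^sub>v v) $ i = (\<Sum>j = 0..<a. (if i = j then 1 else 0) * v $ j)"
        using that vc by (simp add: scalar_prod_def)
      then show ?thesis using that I v(2) by (simp add: sum_if_eq_mult)
    qed
    define w where "w = vec (a - I) (\<lambda>j. v $ (I + j))"
    have w: "w \<in> carrier_vec (a - I)" by (simp add: w_def)
    have "?D *\<^sub>v w = 0\<^sub>v (a - I)"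
    proof (rule eq_vecI)
      fix i assume "i < dim_vec (0\<^sub>v (a - I))"
      then have i: "i < a - I" by simp
      have "(y *\<^sub>v v) $ i = (\<Sum>j = 0..<a. y $$ (i, j) * v $ j)"
        using i y vc by (auto simp: scalar_prod_def)
      also have "\<dots> = (\<Sum>j = I..<a. y $$ (i, j) * v $ j)"
        by (rule sum.mono_neutral_right) (auto simp: v0)
      also have "\<dots> = (\<Sum>j = 0..<a - I. y $$ (i, I + j) * v $ (I + j))"
        by (rule sum.reindex_bij_witness[of _ "\<lambda>j. I + j" "\<lambda>j. j - I"]) (use I in auto)
      also have "\<dots> = (?D *\<^sub>v w) $ i"
        using i by (auto simp: scalar_prod_def w_def)
      finally show "(?D *\<^sub>v w) $ i = 0\<^sub>v (a - I) $ i" using yv i by simp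
    qed simp
    then have "w = 0\<^sub>v (a - I)"
      using det w det_0_iff_vec_prod_zero_field[OF mat_carrier[of "a - I" "a - I"]] by blast
    then have "w $ j = 0" if "j < a - I" for j
      using that by simp
    then have "v $ (I + j) = 0" if "j < a - I" for j
      using that unfolding w_def by simp
    then have "v $ i = 0" if "i < a" for i
      using that v0[of i] I by (cases "i < I") (auto simp: not_less le_iff_add)
    then show ?thesis using vc by (intro eq_vecI) simp_all
  qed
  have zero: "0\<^sub>v a \<in> mat_kernel y" "?M *\<^sub>v 0\<^sub>v a = 0\<^sub>v I"
    using y by (auto simp: mat_kernel[OF y] intro: eq_vecI)
  have one: "mat_kernel (1\<^sub>m m) = {0\<^sub>v m :: 'a vec}" for m
    by (auto simp: mat_kernel[of _ m m])
  \<comment> \<open>Kernels of identity matrices play the zero space and the kernel of a zero matrix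
    the whole space, so the comparison of quotients embeds \<open>ker y\<close> into the space of
    the first \<open>I\<close> coordinates.\<close>
  have "mat_kernel (1\<^sub>m a) = {v \<in> mat_kernel y. ?M *\<^sub>v v \<in> mat_kernel (1\<^sub>m I)}"
    unfolding one using inj zero by blast
  moreover have "?M *\<^sub>v v \<in> mat_kernel (0\<^sub>m 1 I)" if "v \<in> mat_kernel y" for v
  proof -
    have "?M *\<^sub>v v \<in> carrier_vec I"
      using mat_kernelD(1)[OF y that] by (rule mult_mat_vec_carrier[OF mat_carrier])
    then show ?thesis by (auto simp: mat_kernel[of _ 1 I])
  qed
  moreover have "mat_kernel (1\<^sub>m I :: 'a mat) \<subseteq> mat_kernel (0\<^sub>m 1 I)"
    by (auto simp: mat_kernel[of _ 1 I] mat_kernel[of _ I I])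
  ultimately have "kernel_dim y + kernel_dim (1\<^sub>m I :: 'a mat)
      \<le> kernel_dim (1\<^sub>m a :: 'a mat) + kernel_dim (0\<^sub>m 1 I :: 'a mat)"
    by (intro kernel_dim_quotient_mono[OF y one_carrier_mat zero_carrier_mat one_carrier_mat mat_carrier])
  then show ?thesis using kernel_dim_0[where 'a='a, of 1 I] by (simp add: kernel_dim_1)
qed

text \<open>If \<open>x\<close> maps into the span of the first \<open>b\<close> unit vectors, then it induces an
  injection of \<open>ker x\<^sup>p\<^sup>+\<^sup>1 / ker x\<^sup>p\<close> into \<open>ker y\<^sup>p / ker y\<^sup>p\<^sup>-\<^sup>1\<close>, where \<open>y\<close> is
  the upper left block.\<close>

lemma kernel_dim_power_mono:
  fixes x :: "'a::field mat"
  assumes x: "x \<in> carrier_mat a a" and b: "b \<le> a"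
    and zero: "\<And>i j. b \<le> i \<Longrightarrow> i < a \<Longrightarrow> j < a \<Longrightarrow> x $$ (i, j) = 0"
  defines "y \<equiv> mat b b (\<lambda>(i, j). x $$ (i, j))"
  shows "kernel_dim (x ^\<^sub>m (p + 2)) + kernel_dim (y ^\<^sub>m p)
    \<le> kernel_dim (x ^\<^sub>m (p + 1)) + kernel_dim (y ^\<^sub>m (p + 1))"
proof -
  \<comment> \<open>\<open>x\<close> factors as \<open>P * M\<close> through the first
    \<open>b\<close> coordinates, and the factors in the other order give \<open>y\<close>. Hence
    \<open>x^(q+1) = P y^q M\<close>; as \<open>P\<close> is injective, \<open>ker x^(q+1)\<close>
    is the preimage of \<open>ker y^q\<close> under \<open>M\<close>.\<close>
  define M where "M = mat b a (\<lambda>(i, j). x $$ (i, j))"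
  define P where "P = mat a b (\<lambda>(i, j). if i = j then 1 else 0 :: 'a)"
  have y: "y \<in> carrier_mat b b" and M: "M \<in> carrier_mat b a" and P: "P \<in> carrier_mat a b"
    by (auto simp: y_def M_def P_def)
  have PM: "P * M = x"
  proof (rule eq_matI)
    fix i j assume "i < dim_row x" "j < dim_col x"
    then have ij: "i < a" "j < a" using x by auto
    have "(P * M) $$ (i, j) = (\<Sum>k = 0..<b. (if i = k then 1 else 0) * x $$ (k, j))"
      using ij P M by (simp add: scalar_prod_def P_def M_def)
    then show "(P * M) $$ (i, j) = x $$ (i, j)" using ij zero[of i j] by (simp add: sum_if_eq_mult)
  qed (use x P M in auto)
  have MP: "M * P = y"
  proof (rule eq_matI)
    fix i j assume "i < dim_row y" "j < dim_col y"
    then have ij: "i < b" "j < b" using y by auto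
    have "(M * P) $$ (i, j) = (\<Sum>k = 0..<a. x $$ (i, k) * (if k = j then 1 else 0))"
      using ij b P M by (simp add: scalar_prod_def P_def M_def)
    also have "\<dots> = (\<Sum>k = 0..<a. if k = j then x $$ (i, k) else 0)"
      by (rule sum.cong) auto
    finally show "(M * P) $$ (i, j) = y $$ (i, j)" using ij b by (simp add: y_def)
  qed (use y P M in auto)
  have pow: "x ^\<^sub>m (q + 1) = P * (y ^\<^sub>m q) * M" for q
  proof (induction q)
    case 0
    then show ?case using P M y PM by simp
  next
    case (Suc q)
    have yq: "y ^\<^sub>m q \<in> carrier_mat b b" using y by simp
    have "x ^\<^sub>m (Suc q + 1) = (P * y ^\<^sub>m q * M) * (P * M)"
      using Suc PM by simp
    also have "\<dots> = P * y ^\<^sub>m q * (M * P) * M"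
      using P M yq by (simp add: assoc_mult_mat[of _ a b _ b _ a] assoc_mult_mat[of _ a b _ a _ a]
        assoc_mult_mat[of _ b a _ b _ a] assoc_mult_mat[of _ b b _ b _ a]
        assoc_mult_mat[of _ b b _ a _ a])
    also have "\<dots> = P * (y ^\<^sub>m Suc q) * M"
      using P yq y by (simp add: MP assoc_mult_mat[of _ a b _ b _ b])
    finally show ?case .
  qed
  have inj: "w = 0\<^sub>v b" if w: "w \<in> carrier_vec b" "P *\<^sub>v w = 0\<^sub>v a" for w
  proof (rule eq_vecI)
    fix i assume "i < dim_vec (0\<^sub>v b)"
    then have i: "i < b" by simp
    have "(P *\<^sub>v w) $ i = (\<Sum>k = 0..<b. (if i = k then 1 else 0) * w $ k)"
      using i b w(1) by (simp add: P_def scalar_prod_def)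
    moreover have "(P *\<^sub>v w) $ i = 0" using i b by (simp add: w(2))
    ultimately show "w $ i = 0\<^sub>v b $ i" using i by (simp add: sum_if_eq_mult)
  qed (use w in simp)
  have iff: "v \<in> mat_kernel (x ^\<^sub>m (q + 1)) \<longleftrightarrow> M *\<^sub>v v \<in> mat_kernel (y ^\<^sub>m q)"
    if v: "v \<in> carrier_vec a" for v q
  proof -
    have yq: "y ^\<^sub>m q \<in> carrier_mat b b" and Mv: "M *\<^sub>v v \<in> carrier_vec b"
      using y M v by simp_all
    then have yMv: "y ^\<^sub>m q *\<^sub>v (M *\<^sub>v v) \<in> carrier_vec b" by simp
    have "x ^\<^sub>m (q + 1) *\<^sub>v v = P *\<^sub>v (y ^\<^sub>m q *\<^sub>v (M *\<^sub>v v))"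
      unfolding pow using P yq M v Mv
      by (simp add: assoc_mult_mat_vec[of _ a b _ a] assoc_mult_mat_vec[of _ a b _ b])
    then have "x ^\<^sub>m (q + 1) *\<^sub>v v = 0\<^sub>v a \<longleftrightarrow> y ^\<^sub>m q *\<^sub>v (M *\<^sub>v v) = 0\<^sub>v b"
      using inj[OF yMv] P by auto
    then show ?thesis
      using v Mv mat_kernel[OF pow_carrier_mat[OF x]] mat_kernel[OF yq] by blast
  qed
  have xq: "x ^\<^sub>m q \<in> carrier_mat a a" and yq: "y ^\<^sub>m q \<in> carrier_mat b b" for q
    using x y by simp_all
  have "y ^\<^sub>m (p + 1) = y * y ^\<^sub>m p"
  proof (induction p)
    case (Suc p)
    then show ?case using assoc_mult_mat[OF y yq y, of p] by simp
  qed (use y in simp)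
  then have suby: "mat_kernel (y ^\<^sub>m p) \<subseteq> mat_kernel (y ^\<^sub>m (p + 1))"
    using mat_kernel_mult_subset[OF yq y] by metis
  have subx: "mat_kernel (x ^\<^sub>m (p + 1)) \<subseteq> mat_kernel (x ^\<^sub>m (p + 2))"
  proof
    fix v assume v: "v \<in> mat_kernel (x ^\<^sub>m (p + 1))"
    then have "v \<in> carrier_vec a" using mat_kernelD(1)[OF xq] by blast
    then show "v \<in> mat_kernel (x ^\<^sub>m (p + 2))"
      using v suby iff[of v p] iff[of v "p + 1"] by auto
  qed
  show ?thesis
  proof (rule kernel_dim_quotient_mono[OF xq xq yq yq M suby])
    fix v assume v: "v \<in> mat_kernel (x ^\<^sub>m (p + 2))"
    then have "v \<in> carrier_vec a" using mat_kernelD(1)[OF xq] by blast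
    then show "M *\<^sub>v v \<in> mat_kernel (y ^\<^sub>m (p + 1))" using v iff[of v "p + 1"] by simp
  next
    have "v \<in> carrier_vec a" if "v \<in> mat_kernel (x ^\<^sub>m q)" for v q
      using that mat_kernelD(1)[OF xq] by blast
    then show "mat_kernel (x ^\<^sub>m (p + 1)) =
        {v \<in> mat_kernel (x ^\<^sub>m (p + 2)). M *\<^sub>v v \<in> mat_kernel (y ^\<^sub>m p)}"
      using subx iff[of _ p] by blast
  qed
qed

text \<open>This is the dimension of generalized eigenspaces for the eigenvalue 0:
  \<open>char_matrix y 0\<close> is \<open>y\<close>, and all Jordan blocks belong to that
  eigenvalue.\<close>

lemma nilpotent_jordan_type_kernel_dim:
  assumes "nilpotent_jordan_type y \<mu>"
  shows "kernel_dim (y ^\<^sub>m k) = (\<Sum>n\<leftarrow>\<mu>. min k n)"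
proof -
  have j: "jordan_nf y (map (\<lambda>n. (n, 0)) \<mu>)" using assms by (simp add: nilpotent_jordan_type_def)
  then have sim: "similar_mat y (jordan_matrix (map (\<lambda>n. (n, 0)) \<mu>))"
    unfolding jordan_nf_def by blast
  then obtain P Q where "similar_mat_wit y (jordan_matrix (map (\<lambda>n. (n, 0)) \<mu>)) P Q"
    unfolding similar_mat_def by blast
  from similar_mat_witD(4)[OF refl this] obtain n where y: "y \<in> carrier_mat n n" by blast
  have cm: "char_matrix y 0 = y"
    using y by (intro eq_matI) (simp_all add: char_matrix_def)
  have blocks: "map fst (filter (\<lambda>(n, e). e = 0) (map (\<lambda>n. (n, 0::complex)) \<mu>)) = \<mu>"
    by (induction \<mu>) simp_all
  show ?thesis
    using dim_gen_eigenspace[OF j, of 0 k] unfolding dim_gen_eigenspace_def cm blocks .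
qed

text \<open>\<open>min k n\<close> grows by one exactly for the blocks longer than \<open>k\<close>.
  The increments are thus the column lengths of the Young diagram.\<close>

lemma nilpotent_jordan_type_kernel_dim_diff:
  assumes "nilpotent_jordan_type y \<mu>"
  shows "kernel_dim (y ^\<^sub>m Suc k) = kernel_dim (y ^\<^sub>m k) + length (filter (\<lambda>n. k < n) \<mu>)"
  unfolding nilpotent_jordan_type_kernel_dim[OF assms] by (induction \<mu>) auto

subsection \<open>Rows of tableaux and Jordan types\<close>

lemma nth_le_iff_less_length_filter:
  fixes xs :: "nat list"
  assumes "sorted_wrt (<) xs" "j < length xs"
  shows "xs ! j \<le> k \<longleftrightarrow> j < length (filter (\<lambda>a. a \<le> k) xs)"
  using assms
proof (induction xs arbitrary: j)
  case (Cons x xs)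
  show ?case
  proof (cases "x \<le> k")
    case True
    then show ?thesis using Cons by (cases j) auto
  next
    case False
    then have "\<forall>a \<in> set xs. \<not> a \<le> k" using Cons.prems(1) by auto
    moreover have "\<not> (x # xs) ! j \<le> k"
      using False Cons.prems by (cases j) (auto dest!: bspec[OF _ nth_mem])
    ultimately show ?thesis using False by simp
  qed
qed simp

definition row_length :: "nat list list \<Rightarrow> nat \<Rightarrow> nat \<Rightarrow> nat" where
  "row_length T k r = length (filter (\<lambda>a. a \<le> k) (T ! r))"

text \<open>Rows emptied by the restriction are dropped on the left and have length 0 on the right,
  so they count on neither side. The number is the length of column \<open>p\<close> of the
  subtableau, with columns numbered from 0.\<close>

lemma length_filter_shape_restrict_tableau:
  "length (filter (\<lambda>n. p < n) (shape (restrict_tableau k T)))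
    = card {r. r < length T \<and> p < row_length T k r}"
proof -
  have "filter (\<lambda>n. p < n) (shape (restrict_tableau k T))
      = filter (\<lambda>n. p < n) (map (\<lambda>r. length (filter (\<lambda>a. a \<le> k) r)) T)"
    unfolding shape_def restrict_tableau_def by (induction T) auto
  then show ?thesis
    by (simp add: length_filter_conv_card row_length_def cong: conj_cong)
qed

context
  fixes N :: nat and T :: "nat list list"
  assumes T: "standard_tableau N T"
begin

lemma Nil_notin_set: "[] \<notin> set T"
  using T by (force simp: standard_tableau_def is_partition_def shape_def)

lemma row_of_eq_iff:
  assumes "a \<in> {1..N}"
  shows "row_of T a = r \<longleftrightarrow> r < length T \<and> a \<in> set (T ! r)"
proof -
  have "a \<in> set (concat T)" using T assms by (simp add: standard_tableau_def)
  then obtain ys where "ys \<in> set T" "a \<in> set ys" by auto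
  then obtain q where q: "q < length T" "a \<in> set (T ! q)" by (metis in_set_conv_nth)
  have uniq: "r = q" if "r < length T" "a \<in> set (T ! r)" for r
  proof (rule ccontr)
    assume "r \<noteq> q"
    moreover have dist: "distinct (concat T)" using T by (simp add: standard_tableau_def)
    then have "distinct T" using Nil_notin_set by (simp add: distinct_concat_iff removeAll_id)
    ultimately have "T ! r \<noteq> T ! q" using that(1) q(1) by (simp add: nth_eq_iff_index_eq)
    then have "set (T ! r) \<inter> set (T ! q) = {}"
      using that(1) q(1) dist by (simp add: distinct_concat_iff)
    then show False using that(2) q(2) by blast
  qed
  have "row_of T a = q" unfolding row_of_def using q uniq by blast
  then show ?thesis using q uniq by blast
qed

lemma length_nth_Suc_le: "Suc r < length T \<Longrightarrow> length (T ! Suc r) \<le> length (T ! r)"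
  using T by (auto simp: standard_tableau_def is_partition_def shape_def sorted_wrt_iff_nth_less)

lemma row_length_antimono:
  assumes "r \<le> s" "s < length T"
  shows "row_length T k s \<le> row_length T k r"
  using assms
proof (induction s rule: dec_induct)
  case (step r)
  let ?xs = "T ! r" and ?ys = "T ! Suc r"
  let ?j = "row_length T k r"
  have sorted: "sorted_wrt (<) ?xs" "sorted_wrt (<) ?ys"
    using T step.prems by (auto simp: standard_tableau_def)
  \<comment> \<open>A longer lower row would have an entry of at most \<open>k\<close> directly
    below an entry exceeding \<open>k\<close>.\<close>
  have "\<not> ?j < row_length T k (Suc r)"
  proof
    assume less: "?j < row_length T k (Suc r)"
    then have j: "?j < length ?ys"
      unfolding row_length_def using length_filter_le less_le_trans by blast
    then have j': "?j < length ?xs" using length_nth_Suc_le[OF step.prems] by simp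
    have "?ys ! ?j \<le> k"
      using nth_le_iff_less_length_filter[OF sorted(2) j] less by (simp add: row_length_def)
    moreover have "?xs ! ?j < ?ys ! ?j"
      using T step.prems j by (auto simp: standard_tableau_def)
    ultimately show False
      using nth_le_iff_less_length_filter[OF sorted(1) j', of k] by (simp add: row_length_def)
  qed
  then show ?case using step by simp
qed simp

lemma row_length_full:
  assumes "r < length T"
  shows "0 < row_length T N r"
proof -
  have "T ! r \<noteq> []"
    using Nil_notin_set assms by (metis nth_mem)
  moreover have "set (T ! r) \<subseteq> {1..N}"
    using T assms by (auto simp: standard_tableau_def)
  ultimately show ?thesis by (cases "T ! r") (auto simp: row_length_def)
qed

text \<open>Column \<open>p + 1\<close> at stage \<open>a\<close> is assumed to be at most as long
  as column \<open>p\<close> at stage \<open>b\<close>. If row \<open>r\<close> of length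
  \<open>p\<close> at stage \<open>b\<close> gained two boxes, then rows 0 to \<open>r\<close> would
  all reach column \<open>p + 1\<close>, while only rows above \<open>r\<close> reached column
  \<open>p\<close> before.\<close>

lemma inj_on_row_of:
  assumes ab: "a \<le> N"
    and le: "\<And>p. card {r. r < length T \<and> p + 1 < row_length T a r}
      \<le> card {r. r < length T \<and> p < row_length T b r}"
  shows "inj_on (row_of T) {b<..a}"
proof (rule inj_onI, rule ccontr)
  fix i j assume ij: "i \<in> {b<..a}" "j \<in> {b<..a}" "row_of T i = row_of T j" "i \<noteq> j"
  define r where "r = row_of T i"
  have r: "r < length T" "i \<in> set (T ! r)" "j \<in> set (T ! r)"
    using row_of_eq_iff[of i r] row_of_eq_iff[of j r] ij ab by (auto simp: r_def)
  have card: "row_length T k r = card {x \<in> set (T ! r). x \<le> k}" for k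
  proof -
    have "distinct (T ! r)" using T r(1) by (auto simp: standard_tableau_def distinct_concat_iff)
    then have "card (set (filter (\<lambda>a. a \<le> k) (T ! r))) = row_length T k r"
      unfolding row_length_def by (intro distinct_card) simp
    then show ?thesis by (simp add: set_filter)
  qed
  let ?p = "row_length T b r"
  have "?p + 2 = card ({x \<in> set (T ! r). x \<le> b} \<union> {i, j})"
    using ij by (subst card_Un_disjoint) (auto simp: card)
  also have "\<dots> \<le> row_length T a r"
    unfolding card using r ij by (intro card_mono) auto
  finally have p: "?p + 1 < row_length T a r" by simp
  have "{..r} \<subseteq> {s. s < length T \<and> ?p + 1 < row_length T a s}"
    using p r(1) row_length_antimono[of _ r a] by fastforce
  then have "card {..r} \<le> card {s. s < length T \<and> ?p + 1 < row_length T a s}"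
    by (intro card_mono) auto
  also note le[of ?p]
  also have "{s. s < length T \<and> ?p < row_length T b s} \<subseteq> {..<r}"
    using row_length_antimono[of r _ b] by (fastforce simp: not_less[symmetric])
  then have "card {s. s < length T \<and> ?p < row_length T b s} \<le> card {..<r}"
    by (intro card_mono) auto
  finally show False by simp
qed

text \<open>The row of \<open>a\<close> and all rows above it contain an entry of at most
  \<open>a\<close>. The inequality is strict as rows are numbered from 0.\<close>

lemma less_card_row_length:
  assumes "1 \<le> a" "a \<le> N"
  shows "row_of T a < card {r. r < length T \<and> 0 < row_length T a r}"
proof -
  let ?r = "row_of T a"
  have r: "?r < length T" "a \<in> set (T ! ?r)" using row_of_eq_iff[of a ?r] assms by auto
  then have "a \<in> set (filter (\<lambda>x. x \<le> a) (T ! ?r))" by simp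
  then have "0 < row_length T a ?r" unfolding row_length_def by (metis length_pos_if_in_set)
  then have "{..?r} \<subseteq> {r. r < length T \<and> 0 < row_length T a r}"
    using r(1) row_length_antimono[of _ ?r a] by fastforce
  then have "card {..?r} \<le> card {r. r < length T \<and> 0 < row_length T a r}"
    by (intro card_mono) auto
  then show ?thesis by simp
qed

end

section \<open>Jordan types of upper left blocks\<close>

abbreviation upper_left :: "nat \<Rightarrow> complex mat \<Rightarrow> complex mat" where
  "upper_left k x \<equiv> mat k k (\<lambda>(i, j). x $$ (i, j))"

lemma card_row_length_jordan_type:
  assumes "nilpotent_jordan_type y (shape (restrict_tableau k T))"
  shows "kernel_dim (y ^\<^sub>m Suc p) = kernel_dim (y ^\<^sub>m p) + card {r. r < length T \<and> p < row_length T k r}"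
  using nilpotent_jordan_type_kernel_dim_diff[OF assms]
  by (simp only: length_filter_shape_restrict_tableau)

lemma kernel_dim_jordan_type:
  assumes "nilpotent_jordan_type (mat k k f) (shape (restrict_tableau k T))"
  shows "kernel_dim (mat k k f) = card {r. r < length T \<and> 0 < row_length T k r}"
  using card_row_length_jordan_type[OF assms, of 0] by (simp add: kernel_dim_1)

text \<open>\<open>associated_tableau\<close> starts with \<open>k = 1\<close>; stage 0 occurs for
  the chain that begins with 1, where \<open>b = 0\<close>.\<close>

lemma nilpotent_jordan_type_0:
  assumes "standard_tableau N T"
  shows "nilpotent_jordan_type (mat 0 0 f) (shape (restrict_tableau 0 T))"
proof -
  have "\<forall>r \<in> set T. \<forall>a \<in> set r. \<not> a \<le> 0"
    using assms by (fastforce simp: standard_tableau_def)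
  then have "filter (\<lambda>a. a \<le> 0) r = []" if "r \<in> set T" for r using that by (simp add: filter_empty_conv)
  then have "shape (restrict_tableau 0 T) = []"
    by (auto simp: shape_def restrict_tableau_def filter_empty_conv)
  moreover have "similar_mat_wit (mat 0 0 f) (jordan_matrix []) (1\<^sub>m 0) (1\<^sub>m 0)"
    by (rule similar_mat_witI[of _ _ 0]) (auto simp: jordan_matrix_def)
  ultimately show ?thesis
    by (auto simp: nilpotent_jordan_type_def jordan_nf_def similar_mat_def)
qed

text \<open>With indices from 0, position \<open>(i, j)\<close> carries the root with summands
  \<open>{i<..j}\<close>. On and below the diagonal this set is empty, so strict triangularity
  becomes an instance of the same condition.\<close>

lemma m_space_iff:
  "x \<in> m_space N \<tau> \<longleftrightarrow> x \<in> carrier_mat N N \<and>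
    (\<forall>i < N. \<forall>j < N. {i<..j} \<subseteq> \<tau> \<longrightarrow> x $$ (i, j) = 0)"
proof
  assume x: "x \<in> m_space N \<tau>"
  show "x \<in> carrier_mat N N \<and> (\<forall>i < N. \<forall>j < N. {i<..j} \<subseteq> \<tau> \<longrightarrow> x $$ (i, j) = 0)"
  proof (intro conjI allI impI)
    show "x \<in> carrier_mat N N" using x by (simp add: m_space_def strict_upper_def)
    fix i j assume ij: "i < N" "j < N" "{i<..j} \<subseteq> \<tau>"
    show "x $$ (i, j) = 0"
    proof (cases "j \<le> i")
      case True
      then show ?thesis using x ij by (simp add: m_space_def strict_upper_def)
    next
      case False
      then have "(Suc i, j) \<in> pos_roots_of N \<tau>"
        using ij by (auto simp: pos_roots_of_def pos_roots_def)
      then show ?thesis using x by (force simp: m_space_def entry_def)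
    qed
  qed
next
  assume x: "x \<in> carrier_mat N N \<and> (\<forall>i < N. \<forall>j < N. {i<..j} \<subseteq> \<tau> \<longrightarrow> x $$ (i, j) = 0)"
  have "x $$ (i - 1, j) = 0" if "1 \<le> i" "i \<le> j" "j < N" "{i..j} \<subseteq> \<tau>" for i j
  proof -
    have "{i - 1<..j} = {i..j}" using that by auto
    then have "{i - 1<..j} \<subseteq> \<tau>" using that by simp
    then show ?thesis using x that by auto
  qed
  then show "x \<in> m_space N \<tau>"
    using x by (auto simp: m_space_def strict_upper_def entry_def pos_roots_of_def pos_roots_def)
qed

text \<open>The roots \<open>{b<..<a}\<close> force the rows from index \<open>b\<close> on of the
  upper left \<open>a\<close> by \<open>a\<close> block to vanish. The comparison of kernels of
  powers then becomes the comparison of columns of the subtableaux.\<close>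

lemma inj_on_row_of_jordan_type:
  assumes T: "standard_tableau N T" and x: "x \<in> m_space N \<tau>"
    and ab: "b \<le> a" "a \<le> N" and \<tau>: "{b<..<a} \<subseteq> \<tau>"
    and type: "nilpotent_jordan_type (upper_left a x) (shape (restrict_tableau a T))"
      "nilpotent_jordan_type (upper_left b x) (shape (restrict_tableau b T))"
  shows "inj_on (row_of T) {b<..a}"
proof (rule inj_on_row_of[OF T ab(2)])
  fix p
  let ?x = "upper_left a x" and ?y = "upper_left b x"
  have zero: "?x $$ (i, j) = 0" if "b \<le> i" "i < a" "j < a" for i j
  proof -
    have "{i<..j} \<subseteq> {b<..<a}" using that by auto
    then show ?thesis using that x \<tau> ab by (auto simp: m_space_iff)
  qed
  have y: "mat b b (\<lambda>(i, j). ?x $$ (i, j)) = ?y" using ab(1) by auto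
  have "kernel_dim (?x ^\<^sub>m (p + 2)) + kernel_dim (?y ^\<^sub>m p)
    \<le> kernel_dim (?x ^\<^sub>m (p + 1)) + kernel_dim (?y ^\<^sub>m (p + 1))"
    using kernel_dim_power_mono[of ?x a b p, OF _ ab(1) zero] unfolding y by simp
  then show "card {r. r < length T \<and> p + 1 < row_length T a r}
      \<le> card {r. r < length T \<and> p < row_length T b r}"
    using card_row_length_jordan_type[OF type(1), of "p + 1"]
      card_row_length_jordan_type[OF type(2), of p]
    by simp
qed

subsection \<open>Minors of the generic matrix\<close>

lemma generic_matrix_nth:
  "i < N \<Longrightarrow> j < N \<Longrightarrow>
    generic_matrix N \<tau> $$ (i, j) = (if {i<..j} \<subseteq> \<tau> then 0 else cvar (Suc i, Suc j))"
  by (auto simp: generic_matrix_def Let_def pos_roots_of_def pos_roots_def atLeastSucAtMost_greaterThanAtMost)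

text \<open>The position is flexible because the argument also uses the corner minors of upper left
  blocks of the matrix and the two diagonal blocks into which the full minor may split.\<close>

definition generic_minor :: "nat \<Rightarrow> nat set \<Rightarrow> nat \<Rightarrow> nat \<Rightarrow> nat \<Rightarrow> cpoly" where
  "generic_minor N \<tau> r s n = det (mat n n (\<lambda>(i, j). generic_matrix N \<tau> $$ (r + i, s + j)))"

lemma ceval_0 [simp]: "ceval x 0 = 0"
  by (simp add: ceval_def)

lemma ceval_generic_minor:
  assumes x: "x \<in> m_space N \<tau>" and "r + n \<le> N" "s + n \<le> N"
  shows "ceval x (generic_minor N \<tau> r s n) = det (mat n n (\<lambda>(i, j). x $$ (r + i, s + j)))"
  unfolding generic_minor_def ceval_det
proof (intro arg_cong[of _ _ det] eq_matI)
  fix i j assume "i < dim_row (mat n n (\<lambda>(i, j). x $$ (r + i, s + j)))"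
    "j < dim_col (mat n n (\<lambda>(i, j). x $$ (r + i, s + j)))"
  then have ij: "i < n" "j < n" by simp_all
  then have "r + i < N" "s + j < N" using assms by simp_all
  then have "ceval x (generic_matrix N \<tau> $$ (r + i, s + j)) = x $$ (r + i, s + j)"
    using x by (auto simp: generic_matrix_nth m_space_iff entry_def)
  then show "mat n n (\<lambda>ij. ceval x ((\<lambda>(i, j). generic_matrix N \<tau> $$ (r + i, s + j)) ij)) $$ (i, j)
      = mat n n (\<lambda>(i, j). x $$ (r + i, s + j)) $$ (i, j)"
    using ij by simp
qed simp_all

lemma cvars_cvar [simp]: "cvars (cvar v) = {v}"
  by (simp add: cvars_def cvar_def)

lemma cvars_0 [simp]: "cvars 0 = {}"
  by (simp add: cvars_def)

lemma cvars_generic_minor: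
  assumes "r + n \<le> N" "s + n \<le> N"
  shows "cvars (generic_minor N \<tau> r s n)
    \<subseteq> {(Suc i, Suc j) | i j. r \<le> i \<and> i < r + n \<and> s \<le> j \<and> j < s + n \<and> \<not> {i<..j} \<subseteq> \<tau>}"
  unfolding generic_minor_def
  by (rule cvars_det) (use assms in \<open>auto simp: generic_matrix_nth\<close>)

lemma generic_minor_in_S_n:
  assumes "r + n \<le> N" "s + n \<le> N"
  shows "generic_minor N \<tau> r s n \<in> S_n N"
proof -
  have "i < j" if "\<not> {i<..j} \<subseteq> \<tau>" for i j :: nat using that by (cases "i < j") auto
  then show ?thesis
    using cvars_generic_minor[OF assms, of \<tau>] assms unfolding S_n_def by fastforce
qed

text \<open>These matrices are the test points: the full minor takes the value \<open>det M\<close>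
  at them.\<close>

definition super_diagonal :: "nat \<Rightarrow> nat \<Rightarrow> complex mat \<Rightarrow> complex mat" where
  "super_diagonal N I M = mat N N (\<lambda>(i, j). if i < N - I \<and> I \<le> j then M $$ (i, j - I) else 0)"

lemma super_diagonal_in_m_space:
  assumes "\<And>i j. i < N - I \<Longrightarrow> j < N - I \<Longrightarrow> {i<..I + j} \<subseteq> \<tau> \<Longrightarrow> M $$ (i, j) = 0"
  shows "super_diagonal N I M \<in> m_space N \<tau>"
  unfolding m_space_iff
proof (intro conjI allI impI)
  fix i j assume ij: "i < N" "j < N" "{i<..j} \<subseteq> \<tau>"
  show "super_diagonal N I M $$ (i, j) = 0"
    using ij assms[of i "j - I"] by (auto simp: super_diagonal_def)
qed (simp add: super_diagonal_def)

lemma minor_super_diagonal: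
  assumes "M \<in> carrier_mat (N - I) (N - I)"
  shows "mat (N - I) (N - I) (\<lambda>(i, j). super_diagonal N I M $$ (0 + i, I + j)) = M"
  by (rule eq_matI) (use assms in \<open>auto simp: super_diagonal_def\<close>)

text \<open>By \<open>free\<close>, the positions \<open>(i, i + I)\<close> carry variables. With
  these set to 1 and all others to 0, every block along this diagonal is an identity matrix.\<close>

lemma generic_minor_nonzero:
  assumes free: "\<And>i. i + I < N \<Longrightarrow> \<not> {i<..i + I} \<subseteq> \<tau>" and n: "I + r + n \<le> N"
  obtains x where "x \<in> m_space N \<tau>" "ceval x (generic_minor N \<tau> r (I + r) n) \<noteq> 0"
proof -
  let ?x = "super_diagonal N I (1\<^sub>m (N - I))"
  have x: "?x \<in> m_space N \<tau>"
    by (rule super_diagonal_in_m_space) (use free in \<open>auto simp: add.commute\<close>)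
  have "mat n n (\<lambda>(i, j). ?x $$ (r + i, I + r + j)) = 1\<^sub>m n"
    by (rule eq_matI) (use n in \<open>auto simp: super_diagonal_def\<close>)
  then have "ceval ?x (generic_minor N \<tau> r (I + r) n) = 1"
    using n by (subst ceval_generic_minor[OF x]) simp_all
  with x show ?thesis by (intro that[of ?x]) simp_all
qed

lemma generic_minor_neq_0:
  assumes "\<And>i. i + I < N \<Longrightarrow> \<not> {i<..i + I} \<subseteq> \<tau>" and "I + r + n \<le> N"
  shows "generic_minor N \<tau> r (I + r) n \<noteq> 0"
  using generic_minor_nonzero[OF assms] by (metis ceval_0)

text \<open>The roots in \<open>\<tau>\<close> join the \<open>I\<close> numbers
  \<open>b + 1\<close> to \<open>b + I\<close>, which makes the block upper block triangular. An
  identity between values suffices for use with irreducibility of \<open>V\<close>.\<close>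

lemma ceval_generic_minor_block:
  assumes x: "x \<in> m_space N \<tau>" and \<tau>: "{b<..<I + b} \<subseteq> \<tau>" and b: "b \<le> n" "I + n \<le> N"
  shows "ceval x (generic_minor N \<tau> 0 I n)
    = ceval x (generic_minor N \<tau> 0 I b) * ceval x (generic_minor N \<tau> b (I + b) (n - b))"
proof -
  let ?A = "mat b b (\<lambda>(i, j). x $$ (0 + i, I + j))"
  let ?B = "mat b (n - b) (\<lambda>(i, j). x $$ (i, I + b + j))"
  let ?D = "mat (n - b) (n - b) (\<lambda>(i, j). x $$ (b + i, I + b + j))"
  have zero: "x $$ (i, I + j) = 0" if "b \<le> i" "i < n" "j < b" for i j
  proof -
    have "{i<..I + j} \<subseteq> {b<..<I + b}" using that by auto
    then show ?thesis using x \<tau> that b by (auto simp: m_space_iff)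
  qed
  have "mat n n (\<lambda>(i, j). x $$ (0 + i, I + j)) = four_block_mat ?A ?B (0\<^sub>m (n - b) b) ?D"
    by (rule eq_matI) (use b zero in \<open>auto simp: not_less add.assoc\<close>)
  moreover have "det (four_block_mat ?A ?B (0\<^sub>m (n - b) b) ?D) = det ?A * det ?D"
    by (rule det_four_block_mat_lower_left_zero) auto
  ultimately show ?thesis
    using x b by (simp add: ceval_generic_minor)
qed

section \<open>Degrees of minors in a single row or column\<close>

lemma degree_det_le:
  fixes A :: "'a::idom poly mat"
  assumes A: "A \<in> carrier_mat n n"
    and deg: "\<And>i j. i < n \<Longrightarrow> j < n \<Longrightarrow> degree (A $$ (i, j)) \<le> w i j"
    and le: "\<And>p. p permutes {0..<n} \<Longrightarrow> (\<Sum>i = 0..<n. w i (p i)) \<le> d"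
  shows "degree (det A) \<le> d"
  unfolding det_def'[OF A]
proof (rule degree_sum_le)
  fix p assume "p \<in> {p. p permutes {0..<n}}"
  then have p: "p permutes {0..<n}" by simp
  have "degree (signof p * (\<Prod>i = 0..<n. A $$ (i, p i))) \<le> degree (\<Prod>i = 0..<n. A $$ (i, p i))"
    by (cases p rule: sign_cases) simp_all
  also have "\<dots> \<le> (\<Sum>i = 0..<n. degree (A $$ (i, p i)))"
    using degree_prod_sum_le[of "{0..<n}" "\<lambda>i. A $$ (i, p i)"] by (simp add: o_def)
  also have "\<dots> \<le> (\<Sum>i = 0..<n. w i (p i))"
  proof (rule sum_mono)
    fix i assume "i \<in> {0..<n}"
    then show "degree (A $$ (i, p i)) \<le> w i (p i)"
      using permutes_in_image[OF p, of i] by (intro deg) auto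
  qed
  also have "\<dots> \<le> d" by (rule le[OF p])
  finally show "degree (signof p * (\<Prod>i = 0..<n. A $$ (i, p i))) \<le> d" .
qed (simp add: finite_permutations)

lemma degree_generic_minor:
  assumes rs: "r + n \<le> N" "s + n \<le> N"
    and W: "\<And>i j. i < n \<Longrightarrow> j < n \<Longrightarrow> (Suc (r + i), Suc (s + j)) \<in> W \<Longrightarrow> w i j = 1"
    and le: "\<And>p. p permutes {0..<n} \<Longrightarrow> (\<Sum>i = 0..<n. w i (p i)) \<le> (d::nat)"
  shows "degree (scale_vars W (generic_minor N \<tau> r s n)) \<le> d"
proof -
  interpret comm_ring_hom "scale_vars W" by (rule comm_ring_hom_scale_vars)
  show ?thesis
    unfolding generic_minor_def hom_det[symmetric]
  proof (rule degree_det_le[where n = n and w = w, OF _ _ le])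
    fix i j assume "i < n" "j < n"
    then show "degree (map_mat (scale_vars W) (mat n n (\<lambda>(i, j). generic_matrix N \<tau> $$ (r + i, s + j)))
        $$ (i, j)) \<le> w i j"
      using rs W[of i j] by (auto simp: generic_matrix_nth)
  qed auto
qed

lemma degree_generic_minor_row:
  assumes "r + n \<le> N" "s + n \<le> N"
  shows "degree (scale_vars ({k} \<times> UNIV) (generic_minor N \<tau> r s n)) \<le> 1"
proof (rule degree_generic_minor[where w = "\<lambda>i j. if Suc (r + i) = k then 1 else 0", OF assms])
  fix p
  \<comment> \<open>For \<open>k \<le> r\<close> the subtraction truncates to 0, so only an
    inequality holds.\<close>
  have "(\<Sum>i = 0..<n. if Suc (r + i) = k then 1 else 0 :: nat)
      \<le> (\<Sum>i = 0..<n. if i = k - Suc r then 1 else 0)"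
    by (rule sum_mono) auto
  then show "(\<Sum>i = 0..<n. if Suc (r + i) = k then 1 else 0 :: nat) \<le> 1"
    by (auto split: if_splits)
qed auto

lemma degree_generic_minor_column:
  assumes "r + n \<le> N" "s + n \<le> N"
  shows "degree (scale_vars (UNIV \<times> {l}) (generic_minor N \<tau> r s n)) \<le> 1"
proof (rule degree_generic_minor[where w = "\<lambda>i j. if Suc (s + j) = l then 1 else 0", OF assms])
  fix p assume p: "p permutes {0..<n}"
  have "(\<Sum>i = 0..<n. if Suc (s + p i) = l then 1 else 0 :: nat)
      = (\<Sum>i = 0..<n. if Suc (s + i) = l then 1 else 0)"
    using sum.permute[OF p, of "\<lambda>i. if Suc (s + i) = l then 1 else 0 :: nat"] by (simp add: o_def)
  also have "\<dots> \<le> (\<Sum>i = 0..<n. if i = l - Suc s then 1 else 0)"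
    by (rule sum_mono) auto
  finally show "(\<Sum>i = 0..<n. if Suc (s + p i) = l then 1 else 0 :: nat) \<le> 1"
    by (auto split: if_splits)
qed auto

text \<open>Degrees in \<open>W\<close> add up, so a product of degree at most one has at most one
  factor involving variables of \<open>W\<close>.\<close>

lemma cvars_factors_disjoint:
  assumes "f \<noteq> 0" "g \<noteq> 0" "degree (scale_vars W (f * g)) \<le> 1"
    and "v \<in> cvars f" "v \<in> W" "u \<in> W"
  shows "u \<notin> cvars g"
proof -
  have "degree (scale_vars W f) \<noteq> 0" using assms by (auto simp: degree_scale_vars_eq_0_iff)
  then have "degree (scale_vars W g) = 0"
    using degree_scale_vars_mult[OF assms(1,2), of W] assms(3) by simp
  then show ?thesis using assms by (auto simp: degree_scale_vars_eq_0_iff)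
qed

text \<open>Scaling a row whose only non-zero entry is at \<open>(k, l)\<close> changes only the value of one
  variable, but also the value of the minor.\<close>

lemma in_cvars_generic_minor:
  fixes M :: "complex mat"
  assumes M: "M \<in> carrier_mat (N - I) (N - I)" "det M \<noteq> 0"
    and free: "\<And>i j. i < N - I \<Longrightarrow> j < N - I \<Longrightarrow> {i<..I + j} \<subseteq> \<tau> \<Longrightarrow> M $$ (i, j) = 0"
    and I: "I \<le> N" and k: "k < N - I" and row: "\<And>j. j < N - I \<Longrightarrow> j \<noteq> l \<Longrightarrow> M $$ (k, j) = 0"
  shows "(Suc k, Suc (I + l)) \<in> cvars (generic_minor N \<tau> 0 I (N - I))" (is "?v \<in> cvars ?D")
proof (rule ccontr)
  assume "?v \<notin> cvars ?D"
  let ?M0 = "multrow k 0 M"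
  let ?x = "super_diagonal N I M" and ?y = "super_diagonal N I ?M0"
  have M0: "?M0 \<in> carrier_mat (N - I) (N - I)" using M by simp
  have M0_nth: "?M0 $$ (i, j) = (if i = k then 0 else M $$ (i, j))" if "i < N - I" "j < N - I" for i j
    using M that by auto
  have x: "?x \<in> m_space N \<tau>" by (rule super_diagonal_in_m_space[OF free])
  have "?M0 $$ (i, j) = 0" if "i < N - I" "j < N - I" "{i<..I + j} \<subseteq> \<tau>" for i j
    unfolding M0_nth[OF that(1,2)] using free[OF that] by simp
  then have x0: "?y \<in> m_space N \<tau>" by (rule super_diagonal_in_m_space)
  have val: "ceval (super_diagonal N I A) ?D = det A"
    if "A \<in> carrier_mat (N - I) (N - I)" "super_diagonal N I A \<in> m_space N \<tau>" for A
    using ceval_generic_minor[OF that(2), of 0 "N - I" I] I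
    unfolding minor_super_diagonal[OF that(1)] by simp
  have "ceval ?x ?D = det M" "ceval ?y ?D = det ?M0"
    by (rule val[OF M(1) x], rule val[OF M0 x0])
  moreover have "det ?M0 = 0"
    using det_multrow[OF k M(1), of 0] by simp
  moreover have "ceval ?x ?D = ceval ?y ?D"
  proof (rule ceval_cong)
    fix v assume v: "v \<in> cvars ?D"
    then obtain i j where ij: "v = (Suc i, Suc j)" "i < N - I" "I \<le> j" "j < N"
      using cvars_generic_minor[of 0 "N - I" N I \<tau>] I by auto
    have "\<not> (i = k \<and> j = I + l)" using v ij \<open>?v \<notin> cvars ?D\<close> by auto
    then have "M $$ (i, j - I) = ?M0 $$ (i, j - I)"
      using M0_nth[of i "j - I"] row[of "j - I"] ij by auto
    then show "entry ?x v = entry ?y v"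
      using ij by (simp add: entry_def super_diagonal_def)
  qed
  ultimately show False using M(2) by simp
qed

text \<open>The variables of a row or a column cannot be shared between the two factors. The
  diagonal variable links row \<open>i\<close> to column \<open>i\<close>, the subdiagonal one links
  column \<open>i\<close> to row \<open>i + 1\<close>; thus \<open>f\<close>, which has a variable
  of the first row, takes all rows.\<close>

lemma cvars_cofactor_generic_minor:
  assumes I: "I \<le> N" and D: "generic_minor N \<tau> 0 I (N - I) = f * g"
    and free: "\<And>i. i + I < N \<Longrightarrow> \<not> {i<..i + I} \<subseteq> \<tau>"
    and free': "\<And>i. Suc i + I < N \<Longrightarrow> \<not> {Suc i<..i + I} \<subseteq> \<tau>"
    and f: "(1, j0) \<in> cvars f"
  shows "cvars g = {}"
proof -
  let ?n = "N - I" and ?D = "generic_minor N \<tau> 0 I (N - I)"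
  have nz: "f \<noteq> 0" "g \<noteq> 0" using generic_minor_neq_0[of I N \<tau> 0 ?n, OF free] D I by auto
  have row: "(k, l') \<notin> cvars g" if "(k, l) \<in> cvars f" for k l l'
    using cvars_factors_disjoint[OF nz _ that, of "{k} \<times> UNIV" "(k, l')"]
      degree_generic_minor_row[of 0 ?n N I k \<tau>] I D by auto
  have col: "(k', l) \<notin> cvars g" if "(k, l) \<in> cvars f" for k k' l
    using cvars_factors_disjoint[OF nz _ that, of "UNIV \<times> {l}" "(k', l)"]
      degree_generic_minor_column[of 0 ?n N I l \<tau>] I D by auto
  have cv: "cvars ?D = cvars f \<union> cvars g" unfolding D by (rule cvars_mult[OF nz])
  have up: "\<not> {i<..I + j} \<subseteq> \<tau>" if "i \<le> j" "j < ?n" for i j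
  proof -
    have "{i<..i + I} \<subseteq> {i<..I + j}" using that by auto
    moreover have "i + I < N" using that by linarith
    ultimately show ?thesis using free[of i] by blast
  qed
  have diag: "(Suc i, Suc (I + i)) \<in> cvars f \<union> cvars g" if i: "i < ?n" for i
    unfolding cv[symmetric]
    by (rule in_cvars_generic_minor[where M = "1\<^sub>m ?n"]) (use I i up in \<open>auto\<close>)
  have sub: "(Suc (Suc i), Suc (I + i)) \<in> cvars f \<union> cvars g" if i: "Suc i < ?n" for i
    unfolding cv[symmetric]
  \<comment> \<open>The swap puts a 1 at \<open>(i + 1, i)\<close>, the variable position given by
    \<open>free'\<close>. The other new entry \<open>(i, i + 1)\<close> lies above the diagonal,
    where \<open>up\<close> applies.\<close>
  proof (rule in_cvars_generic_minor[where M = "swaprows i (Suc i) (1\<^sub>m ?n)"])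
    show "det (swaprows i (Suc i) (1\<^sub>m ?n)) \<noteq> (0 :: complex)"
      using det_swaprows[of i ?n "Suc i" "1\<^sub>m ?n :: complex mat"] i by simp
    fix k j assume kj: "k < ?n" "j < ?n" "{k<..I + j} \<subseteq> \<tau>"
    have "\<not> k \<le> j" using up[of k j] kj by auto
    moreover have "Suc i + I < N" using i by linarith
    then have "\<not> (k = Suc i \<and> j = i)" using free'[of i] kj(3) by (auto simp: add.commute)
    ultimately show "swaprows i (Suc i) (1\<^sub>m ?n) $$ (k, j) = (0 :: complex)"
      using kj i by auto
  qed (use I i in auto)
  have "(Suc i, l) \<notin> cvars g" if "i < ?n" for i l
    using that
  proof (induction i arbitrary: l)
    case 0
    then show ?case using row[OF f] by simp
  next
    case (Suc i)
    then have "(Suc i, Suc (I + i)) \<in> cvars f" using diag[of i] by auto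
    then have "(Suc (Suc i), Suc (I + i)) \<in> cvars f" using col sub[of i] Suc.prems by auto
    then show ?case by (rule row)
  qed
  moreover have "cvars g \<subseteq> {(Suc i, l) | i l. i < ?n}"
    using cvars_generic_minor[of 0 ?n N I \<tau>] cv I by auto
  ultimately show ?thesis by auto
qed

text \<open>The exponent is \<open>N - I - (N - I) = 0\<close>, so the coefficient is the value of
  the determinant at \<open>t = 0\<close>.\<close>

lemma minor_coeff_eq_generic_minor:
  assumes I: "I \<le> N"
  shows "minor_coeff N \<tau> I (N - I) = generic_minor N \<tau> 0 I (N - I)"
proof -
  let ?X = "generic_matrix N \<tau>"
  let ?A = "cMin I (map_mat (\<lambda>a. [:a:]) ?X + [:0, 1:] \<cdot>\<^sub>m 1\<^sub>m N)"
  have X: "?X \<in> carrier_mat N N" by (simp add: generic_matrix_def)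
  have "minor_coeff N \<tau> I (N - I) = poly (det ?A) 0"
    by (simp add: minor_coeff_def minor_poly_def poly_0_coeff_0)
  also have "\<dots> = det (map_mat (\<lambda>p. poly p 0) ?A)"
    by (rule comm_ring_hom.hom_det[OF comm_ring_hom_poly, symmetric])
  also have "map_mat (\<lambda>p. poly p 0) ?A = mat (N - I) (N - I) (\<lambda>(i, j). ?X $$ (0 + i, I + j))"
  proof (rule eq_matI)
    fix i j assume "i < dim_row (mat (N - I) (N - I) (\<lambda>(i, j). ?X $$ (0 + i, I + j)))"
      "j < dim_col (mat (N - I) (N - I) (\<lambda>(i, j). ?X $$ (0 + i, I + j)))"
    then have ij: "i < N - I" "j < N - I" by simp_all
    then show "map_mat (\<lambda>p. poly p 0) ?A $$ (i, j)
        = mat (N - I) (N - I) (\<lambda>(i, j). ?X $$ (0 + i, I + j)) $$ (i, j)"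
      using X by (simp add: cMin_def add.commute)
  qed (use X in \<open>simp_all add: cMin_def\<close>)
  finally show ?thesis by (simp add: generic_minor_def)
qed

subsection \<open>Zariski closures, chains and non-linear generators\<close>

lemma zariski_closed_vanishing:
  "p \<in> S_n N \<Longrightarrow> zariski_closed N {x \<in> strict_upper N. ceval x p = 0}"
  unfolding zariski_closed_def by (rule exI[of _ "{p}"]) auto

lemma subset_zariski_closure: "V \<subseteq> zariski_closure N V"
  by (auto simp: zariski_closure_def)

text \<open>The zero set of a polynomial vanishing on \<open>V\<close> is closed and so contains the
  closure.\<close>

lemma vanishing_ideal_zariski_closure:
  assumes "V \<subseteq> strict_upper N"
  shows "vanishing_ideal N (zariski_closure N V) = vanishing_ideal N V"
proof (intro equalityI subsetI)
  fix p assume "p \<in> vanishing_ideal N V"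
  then have p: "p \<in> S_n N" "\<forall>x \<in> V. ceval x p = 0" by (auto simp: vanishing_ideal_def)
  let ?Z = "{x \<in> strict_upper N. ceval x p = 0}"
  have "zariski_closed N ?Z" "V \<subseteq> ?Z"
    using zariski_closed_vanishing[OF p(1)] p(2) assms by auto
  then have "zariski_closure N V \<subseteq> ?Z" by (auto simp: zariski_closure_def)
  then show "p \<in> vanishing_ideal N (zariski_closure N V)" using p(1) by (auto simp: vanishing_ideal_def)
qed (use subset_zariski_closure[of V N] in \<open>auto simp: vanishing_ideal_def\<close>)

text \<open>The zero sets of \<open>p\<close> and \<open>q\<close> are closed and cover
  \<open>V\<close>, so one of them contains it.\<close>

lemma irreducible_set_vanishing_ideal_prime:
  assumes V: "irreducible_set N V" and pq: "p \<in> S_n N" "q \<in> S_n N"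
    and zero: "\<And>x. x \<in> V \<Longrightarrow> ceval x p * ceval x q = 0"
  shows "p \<in> vanishing_ideal N V \<or> q \<in> vanishing_ideal N V"
proof -
  let ?Y = "{x \<in> strict_upper N. ceval x p = 0}" and ?Z = "{x \<in> strict_upper N. ceval x q = 0}"
  have "zariski_closed N ?Y" "zariski_closed N ?Z"
    by (rule zariski_closed_vanishing[OF pq(1)], rule zariski_closed_vanishing[OF pq(2)])
  moreover have "V \<subseteq> ?Y \<union> ?Z" using V zero by (auto simp: irreducible_set_def)
  ultimately have "V \<subseteq> ?Y \<or> V \<subseteq> ?Z" using V by (simp add: irreducible_set_def)
  then show ?thesis using pq by (auto simp: vanishing_ideal_def)
qed

text \<open>The two exceptional closed sets cannot cover an irreducible set together.\<close>

lemma generically_conj: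
  assumes V: "irreducible_set N V" and P: "generically N V P" and Q: "generically N V Q"
  obtains x where "x \<in> V" "P x" "Q x"
proof -
  from P Q obtain Y Z where "zariski_closed N Y" "\<not> V \<subseteq> Y" "\<forall>x \<in> V - Y. P x"
    "zariski_closed N Z" "\<not> V \<subseteq> Z" "\<forall>x \<in> V - Z. Q x"
    by (auto simp: generically_def)
  moreover from this have "\<not> V \<subseteq> Y \<union> Z" using V unfolding irreducible_set_def by blast
  ultimately show ?thesis using that by blast
qed

lemma generically_nonzero:
  assumes "V \<subseteq> strict_upper N" "p \<in> S_n N" "x \<in> V" "ceval x p \<noteq> 0"
  shows "generically N V (\<lambda>x. ceval x p \<noteq> 0)"
  unfolding generically_def
  using assms zariski_closed_vanishing[OF assms(2)]
  by (intro exI[of _ "{x \<in> strict_upper N. ceval x p = 0}"]) auto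

lemma one_in_S_n: "1 \<in> S_n N"
  by (simp add: S_n_def cvars_def flip: single_one)

lemma generically_True:
  assumes "irreducible_set N V" "\<And>x. P x"
  shows "generically N V P"
proof -
  have "ceval x 1 = 1" for x using ceval_cconst[of x 1] by simp
  then have "zariski_closed N {}" using zariski_closed_vanishing[OF one_in_S_n, of N] by simp
  then show ?thesis
    using assms unfolding generically_def irreducible_set_def by (intro exI[of _ "{}"]) auto
qed

lemma irreducible_set_orbital_variety: "orbital_variety N V \<Longrightarrow> irreducible_set N V"
  by (auto simp: orbital_variety_def irreducible_component_def)

text \<open>Irreducibility supplies a single matrix with the generic Jordan type at both stages
  \<open>a\<close> and \<open>b\<close>.\<close>

lemma inj_on_row_of_associated_tableau:
  assumes V: "irreducible_set N V" "V \<subseteq> m_space N \<tau>" and T: "associated_tableau N V T"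
    and ab: "b < a" "a \<le> N" and \<tau>: "{b<..<a} \<subseteq> \<tau>"
  shows "inj_on (row_of T) {b<..a}"
proof -
  let ?P = "\<lambda>k x. nilpotent_jordan_type (upper_left k x) (shape (restrict_tableau k T))"
  have T': "standard_tableau N T" using T by (simp add: associated_tableau_def)
  have gen: "generically N V (?P k)" if "k \<le> N" for k
  proof (cases "k = 0")
    case True
    then show ?thesis using nilpotent_jordan_type_0[OF T'] by (auto intro: generically_True[OF V(1)])
  next
    case False
    then show ?thesis using T that by (auto simp: associated_tableau_def)
  qed
  obtain x where "x \<in> V" "?P a x" "?P b x"
    using generically_conj[OF V(1) gen[of a] gen[of b]] ab by auto
  then show ?thesis
    using V(2) ab \<tau> by (intro inj_on_row_of_jordan_type[OF T', of x \<tau> b a]) auto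
qed

text \<open>The rows at stage \<open>a\<close> are counted by the generic kernel dimension of the
  upper left block. On a Richardson variety this bounds the rows of the tableau; on \<open>V\<close>
  the contrapositive shows that the minor vanishes.\<close>

lemma card_rows_le:
  assumes V: "irreducible_set N V" "V \<subseteq> m_space N \<tau>" and T: "associated_tableau N V T"
    and a: "1 \<le> a" "a \<le> N" "I \<le> a"
    and notin: "generic_minor N \<tau> 0 I (a - I) \<notin> vanishing_ideal N V"
  shows "card {r. r < length T \<and> 0 < row_length T a r} \<le> I"
proof -
  let ?D = "generic_minor N \<tau> 0 I (a - I)"
  let ?P = "\<lambda>x. nilpotent_jordan_type (upper_left a x) (shape (restrict_tableau a T))"
  have D: "?D \<in> S_n N" by (rule generic_minor_in_S_n) (use a in auto)
  then obtain y where "y \<in> V" "ceval y ?D \<noteq> 0" using notin by (auto simp: vanishing_ideal_def)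
  then have "generically N V (\<lambda>x. ceval x ?D \<noteq> 0)"
    using V(1) D by (intro generically_nonzero) (auto simp: irreducible_set_def)
  moreover have "generically N V ?P" using T a by (auto simp: associated_tableau_def)
  ultimately obtain x where x: "x \<in> V" "ceval x ?D \<noteq> 0" "?P x"
    using generically_conj[OF V(1)] by blast
  have "ceval x ?D = det (mat (a - I) (a - I) (\<lambda>(i, j). x $$ (0 + i, I + j)))"
    using x(1) V(2) a by (intro ceval_generic_minor) auto
  also have "mat (a - I) (a - I) (\<lambda>(i, j). x $$ (0 + i, I + j))
      = mat (a - I) (a - I) (\<lambda>(i, j). upper_left a x $$ (i, I + j))"
    by (rule eq_matI) auto
  finally have "kernel_dim (upper_left a x) \<le> I"
    using x(2) a by (intro kernel_dim_le_of_minor[of _ a]) auto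
  then show ?thesis unfolding kernel_dim_jordan_type[OF x(3)] .
qed

section \<open>Chains as intervals\<close>

lemma transposition_group_orbit:
  "q \<in> (\<lambda>p. p e) ` transposition_group \<tau> \<longleftrightarrow> {min e q..<max e q} \<subseteq> \<tau>"
proof
  assume "q \<in> (\<lambda>p. p e) ` transposition_group \<tau>"
  then obtain p where "p \<in> transposition_group \<tau>" "q = p e" by blast
  then show "{min e q..<max e q} \<subseteq> \<tau>"
  proof (induction arbitrary: q)
    case (tg_step p i)
    consider "p e = i" "q = Suc i" | "p e = Suc i" "q = i" | "q = p e"
      using tg_step.prems by (auto simp: Transposition.transpose_def split: if_splits)
    then show ?case
    proof cases
      case 1
      then have "{min e q..<max e q} \<subseteq> insert i {min e (p e)..<max e (p e)}" by auto
      then show ?thesis using tg_step by blast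
    next
      case 2
      then have "{min e q..<max e q} \<subseteq> insert i {min e (p e)..<max e (p e)}" by auto
      then show ?thesis using tg_step by blast
    next
      case 3
      then show ?thesis using tg_step by blast
    qed
  qed simp
next
  let ?C = "(\<lambda>p. p e) ` transposition_group \<tau>"
  have base: "e \<in> ?C" using tg_id[of \<tau>] by (intro image_eqI[of _ _ id]) auto
  have step: "Transposition.transpose i (i + 1) r \<in> ?C" if r: "r \<in> ?C" and i: "i \<in> \<tau>" for i r
  proof -
    from r obtain p where p: "p \<in> transposition_group \<tau>" "r = p e" by blast
    then have "Transposition.transpose i (i + 1) r = (Transposition.transpose i (i + 1) \<circ> p) e" by simp
    then show ?thesis using tg_step[OF p(1) i] by blast
  qed
  have up: "e + d \<in> ?C" if "{e..<e + d} \<subseteq> \<tau>" for d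
    using that
  proof (induction d)
    case (Suc d)
    then have "{e..<e + d} \<subseteq> \<tau>" "e + d \<in> \<tau>" by auto
    then show ?case using step[OF Suc.IH, of "e + d"] by simp
  qed (use base in simp)
  have down: "e - d \<in> ?C" if "d \<le> e" "{e - d..<e} \<subseteq> \<tau>" for d
    using that
  proof (induction d)
    case (Suc d)
    have "{e - d..<e} \<subseteq> {e - Suc d..<e}" by auto
    then have "{e - d..<e} \<subseteq> \<tau>" using Suc.prems by blast
    then have "e - d \<in> ?C" using Suc by simp
    moreover have "e - Suc d \<in> \<tau>" using Suc.prems by auto
    ultimately have "Transposition.transpose (e - Suc d) (e - Suc d + 1) (e - d) \<in> ?C" by (rule step)
    moreover have "e - d = e - Suc d + 1" using Suc.prems(1) by simp
    ultimately show ?case by (metis transpose_apply_second)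
  qed (use base in simp)
  assume q: "{min e q..<max e q} \<subseteq> \<tau>"
  show "q \<in> ?C"
  proof (cases "e \<le> q")
    case True
    then show ?thesis using up[of "q - e"] q by (simp add: max_def min_def split: if_splits)
  next
    case False
    then show ?thesis using down[of "e - q"] q by simp
  qed
qed

text \<open>The half-open form makes \<open>b\<close> and \<open>a\<close> the sizes of the upper
  left blocks to be compared, and \<open>{b<..<a}\<close> the roots joining the elements of the
  chain.\<close>

lemma chains_interval:
  assumes C: "C \<in> chains N \<tau>" and \<tau>: "\<tau> \<subseteq> simple_roots N"
  obtains a b where "b < a" "a \<le> N" "C = {b<..a}" "{b<..<a} \<subseteq> \<tau>"
proof -
  from C obtain e where e: "1 \<le> e" "e \<le> N" and "C = (\<lambda>p. p e) ` transposition_group \<tau>"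
    by (auto simp: chains_def)
  then have iff: "q \<in> C \<longleftrightarrow> {min e q..<max e q} \<subseteq> \<tau>" for q
    by (simp only: transposition_group_orbit)
  have eC: "e \<in> C" unfolding iff by simp
  have bounds: "1 \<le> q" "q \<le> N" if "q \<in> C" for q
  proof -
    have sub: "i \<in> simple_roots N" if "min e q \<le> i" "i < max e q" for i
      using \<open>q \<in> C\<close>[unfolded iff] \<tau> that by auto
    show "1 \<le> q"
      using sub[of 0] e by (cases "q = 0") (simp_all add: simple_roots_def)
    show "q \<le> N"
      using sub[of N] e by (cases "q \<le> N") (simp_all add: simple_roots_def)
  qed
  then have "C \<subseteq> {1..N}" by auto
  then have fin: "finite C" by (rule finite_subset) simp
  define a c where "a = Max C" and "c = Min C"
  have "C \<noteq> {}" using eC by blast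
  then have in_C: "a \<in> C" "c \<in> C" using Max_in[OF fin] Min_in[OF fin] unfolding a_def c_def by blast+
  have le: "c \<le> e" "e \<le> a" using Min_le[OF fin eC] Max_ge[OF fin eC] unfolding a_def c_def .
  have "{c..<a} = {c..<e} \<union> {e..<a}" using le by auto
  also have "\<dots> \<subseteq> \<tau>"
    using in_C[unfolded iff] le by (simp add: max_absorb2 max_absorb1 min_absorb1 min_absorb2)
  finally have sub: "{c..<a} \<subseteq> \<tau>" .
  have "C = {c..a}"
  proof (intro equalityI subsetI)
    fix q assume "q \<in> {c..a}"
    then have "{min e q..<max e q} \<subseteq> {c..<a}" using le by auto
    then show "q \<in> C" unfolding iff using sub by (rule subset_trans)
  qed (use fin in \<open>auto simp: a_def c_def\<close>)
  also have "\<dots> = {c - 1<..a}" using bounds(1)[OF in_C(2)] by auto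
  finally have C: "C = {c - 1<..a}" .
  have "{c - 1<..<a} = {c..<a}" using bounds(1)[OF in_C(2)] by auto
  then show ?thesis
    using sub C bounds(1)[OF in_C(2)] bounds(2)[OF in_C(1)] le by (intro that[of "c - 1" a]) simp_all
qed

section \<open>Root vectors and the support of a polynomial with full sigma-set\<close>

lemma unit_matrix_mult:
  assumes "1 \<le> j" "j \<le> N"
  shows "unit_matrix N i j * unit_matrix N k l = (if j = k then unit_matrix N i l else 0\<^sub>m N N)"
proof (rule eq_matI)
  fix p q assume "p < dim_row (if j = k then unit_matrix N i l else 0\<^sub>m N N)"
    "q < dim_col (if j = k then unit_matrix N i l else 0\<^sub>m N N)"
  then have pq: "p < N" "q < N" by (auto simp: unit_matrix_def split: if_splits)
  have "(unit_matrix N i j * unit_matrix N k l) $$ (p, q)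
      = (\<Sum>m = 0..<N. (if Suc p = i \<and> Suc m = j then 1 else 0) * (if Suc m = k \<and> Suc q = l then 1 else 0))"
    using pq by (simp add: unit_matrix_def scalar_prod_def)
  also have "\<dots> = (\<Sum>m = 0..<N. if m = j - 1 then (if Suc p = i \<and> j = k \<and> Suc q = l then 1 else 0) else 0)"
    by (rule sum.cong) (use assms in auto)
  also have "\<dots> = (if j = k then unit_matrix N i l else 0\<^sub>m N N) $$ (p, q)"
    using assms pq by (auto simp: unit_matrix_def)
  finally show "(unit_matrix N i j * unit_matrix N k l) $$ (p, q)
      = (if j = k then unit_matrix N i l else 0\<^sub>m N N) $$ (p, q)" .
qed (auto simp: unit_matrix_def)

text \<open>The bracket of the root vectors at \<open>(i, k)\<close> and \<open>(k, k + 1)\<close>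
  is the one at \<open>(i, k + 1)\<close>, since the product in the other order is zero.\<close>

lemma unit_matrix_in_n_sub:
  assumes "i < j" "j \<le> N" "1 \<le> i" "{i..<j} \<subseteq> \<sigma>"
  shows "unit_matrix N i j \<in> n_sub N \<sigma>"
proof -
  have "Suc i \<le> j" using assms by simp
  then show ?thesis
    using assms(2,4)
  proof (induction j rule: dec_induct)
    case base
    then show ?case using n_sub_gen[of i \<sigma> N] by simp
  next
    case (step k)
    then have "{i..<k} \<subseteq> \<sigma>" by auto
    then have "unit_matrix N i k \<in> n_sub N \<sigma>" using step by simp
    moreover have "unit_matrix N k (k + 1) \<in> n_sub N \<sigma>"
      using step by (intro n_sub_gen) auto
    ultimately have "unit_matrix N i k * unit_matrix N k (k + 1) - unit_matrix N k (k + 1) * unit_matrix N i k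
        \<in> n_sub N \<sigma>"
      by (rule n_sub_bracket)
    moreover have "unit_matrix N i k * unit_matrix N k (k + 1) - unit_matrix N k (k + 1) * unit_matrix N i k
        = unit_matrix N i (Suc k)"
      using step assms(3) by (subst (1 2) unit_matrix_mult) (auto simp: unit_matrix_def)
    ultimately show ?case by simp
  qed
qed

text \<open>Without a variable in the first row or in the last column, \<open>f\<close> would
  already lie in the ring of a shorter interval of simple roots.\<close>

lemma connected_support_full:
  assumes conn: "connected_roots N (simple_roots N)" and f: "f \<in> S_n N" "cvars f \<noteq> {}"
    and min: "\<And>\<sigma>. connected_roots N \<sigma> \<Longrightarrow> f \<in> S_n_sub N \<sigma> \<Longrightarrow> simple_roots N \<subseteq> \<sigma>"
  shows "\<exists>j. (1, j) \<in> cvars f" "\<exists>i. (i, N) \<in> cvars f"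
proof -
  have N: "2 \<le> N"
  proof -
    obtain a b where "1 \<le> a" "a \<le> b" "b < N" using conn unfolding connected_roots_def by blast
    then show ?thesis by simp
  qed
  have pos: "1 \<le> i \<and> i < j \<and> j \<le> N" if "(i, j) \<in> cvars f" for i j
    using f(1) that unfolding S_n_def by blast
  have sub: "f \<in> S_n_sub N \<sigma>" if "\<And>i j. (i, j) \<in> cvars f \<Longrightarrow> {i..<j} \<subseteq> \<sigma>" for \<sigma>
    unfolding S_n_sub_def
  proof (intro CollectI conjI ballI, rule f(1))
    fix v assume v: "v \<in> cvars f"
    obtain i j where ij: "v = (i, j)" by (cases v)
    show "case v of (i, j) \<Rightarrow> unit_matrix N i j \<in> n_sub N \<sigma>"
      using unit_matrix_in_n_sub[of i j N \<sigma>] pos[of i j] that[of i j] v by (simp add: ij)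
  qed
  \<comment> \<open>The roots \<open>b\<close> to \<open>c\<close> span the matrix positions with
    rows from \<open>b\<close> and columns up to \<open>Suc c\<close>. A variable of
    \<open>f\<close> shows that this interval is not empty.\<close>
  have no: False if "\<And>i j. (i, j) \<in> cvars f \<Longrightarrow> b \<le> i \<and> j \<le> Suc c" "1 \<le> b" "c < N"
    "\<not> simple_roots N \<subseteq> {b..c}" for b c
  proof -
    obtain i j where "(i, j) \<in> cvars f" using f(2) by auto
    then have "b \<le> c" using that(1)[of i j] pos[of i j] by auto
    then have "connected_roots N {b..c}" using that by (auto simp: connected_roots_def)
    moreover have "f \<in> S_n_sub N {b..c}" using that(1) by (intro sub) fastforce
    ultimately show False using min that(4) by blast
  qed
  show "\<exists>j. (1, j) \<in> cvars f"
  proof (rule ccontr)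
    assume none: "\<nexists>j. (1, j) \<in> cvars f"
    have "2 \<le> i \<and> j \<le> Suc (N - 1)" if "(i, j) \<in> cvars f" for i j
    proof -
      have "i \<noteq> 1" using none that by blast
      then show ?thesis using pos[OF that] by auto
    qed
    then show False by (rule no) (use N in \<open>auto simp: simple_roots_def\<close>)
  qed
  show "\<exists>i. (i, N) \<in> cvars f"
  proof (rule ccontr)
    assume none: "\<nexists>i. (i, N) \<in> cvars f"
    have "1 \<le> i \<and> j \<le> Suc (N - 2)" if "(i, j) \<in> cvars f" for i j
    proof -
      have "j \<noteq> N" using none that by blast
      then show ?thesis using pos[OF that] by auto
    qed
    then show False
    proof (rule no)
      have "N - 1 \<in> simple_roots N - {1..N - 2}" using N by (auto simp: simple_roots_def)
      then show "\<not> simple_roots N \<subseteq> {1..N - 2}" by blast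
    qed (use N in auto)
  qed
qed

section \<open>The non-linear generator and its multiples\<close>

context
  fixes N :: nat and V :: "complex mat set" and f :: cpoly
  assumes V: "V \<subseteq> strict_upper N" and f: "nonlinear_generator N V f"
begin

lemma nonlinear_generatorD:
  shows "cvars f \<subseteq> {(s, t). (s, t - 1) \<in> pos_roots N - pos_roots_of N (tau_invariant N V)}"
    and "irreducible f"
    and "vanishing_ideal N V = ideal_generated N
      (insert f {cvar (s, t) | s t. (s, t - 1) \<in> pos_roots_of N (tau_invariant N V)})"
  using f vanishing_ideal_zariski_closure[OF V] unfolding nonlinear_generator_def Let_def by simp_all

lemma nonlinear_generator_in_S_n: "f \<in> S_n N"
  using nonlinear_generatorD(1) by (force simp: S_n_def pos_roots_def)

lemma ideal_generated_base: "a \<in> A \<Longrightarrow> a \<in> ideal_generated N A"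
  unfolding ideal_generated_def using one_in_S_n
  by (auto intro!: exI[of _ "{a}"] exI[of _ "\<lambda>_. 1"])

lemma nonlinear_generator_vanishes: "f \<in> vanishing_ideal N V"
  unfolding nonlinear_generatorD(3) by (intro ideal_generated_base) simp

lemma nonlinear_generator_subset_m_space: "V \<subseteq> m_space N (tau_invariant N V)"
proof
  fix x assume x: "x \<in> V"
  have "entry x (i, j + 1) = 0" if "(i, j) \<in> pos_roots_of N (tau_invariant N V)" for i j
  proof -
    have "cvar (i, j + 1) \<in> vanishing_ideal N V"
      unfolding nonlinear_generatorD(3) using that by (intro ideal_generated_base) force
    then show ?thesis using x by (auto simp: vanishing_ideal_def)
  qed
  then show "x \<in> m_space N (tau_invariant N V)" using x V by (auto simp: m_space_def)
qed

text \<open>Setting the variables outside \<open>?W\<close> to zero fixes \<open>p\<close> and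
  \<open>f\<close> but kills the linear generators, which leaves \<open>p\<close> as a multiple of
  \<open>f\<close>.\<close>

lemma nonlinear_generator_dvd:
  assumes p: "p \<in> vanishing_ideal N V"
    and cvars: "cvars p \<subseteq> {(s, t). (s, t - 1) \<in> pos_roots N - pos_roots_of N (tau_invariant N V)}"
      (is "_ \<subseteq> ?W")
  shows "f dvd p"
proof -
  let ?L = "{cvar (s, t) | s t. (s, t - 1) \<in> pos_roots_of N (tau_invariant N V)}"
  interpret comm_ring_hom "restrict_vars ?W" by (rule comm_ring_hom_restrict_vars)
  from p obtain F c where F: "p = (\<Sum>a\<in>F. c a * a)" "F \<subseteq> insert f ?L"
    unfolding nonlinear_generatorD(3) ideal_generated_def by blast
  have dvd: "f dvd restrict_vars ?W a" if "a \<in> insert f ?L" for a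
    using that restrict_vars_ident[OF nonlinear_generatorD(1)] by auto
  have "p = restrict_vars ?W p" using restrict_vars_ident[OF cvars] by simp
  also have "\<dots> = (\<Sum>a\<in>F. restrict_vars ?W (c a) * restrict_vars ?W a)"
    unfolding F(1) by (simp only: hom_sum hom_mult)
  finally show ?thesis using F(2) dvd by (auto intro!: dvd_sum)
qed

lemma nonlinear_generator_dvd_generic_minor:
  assumes "generic_minor N (tau_invariant N V) r s n \<in> vanishing_ideal N V" "r + n \<le> N" "s + n \<le> N"
  shows "f dvd generic_minor N (tau_invariant N V) r s n"
proof (rule nonlinear_generator_dvd[OF assms(1)])
  have root: "(Suc i, j) \<in> pos_roots N - pos_roots_of N \<tau>" if "j < N" "\<not> {i<..j} \<subseteq> \<tau>" for i j \<tau>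
  proof -
    have "i < j" using that(2) by (cases "i < j") auto
    then show ?thesis
      using that by (auto simp: pos_roots_def pos_roots_of_def atLeastSucAtMost_greaterThanAtMost)
  qed
  show "cvars (generic_minor N (tau_invariant N V) r s n)
      \<subseteq> {(s, t). (s, t - 1) \<in> pos_roots N - pos_roots_of N (tau_invariant N V)}"
  proof
    fix v assume "v \<in> cvars (generic_minor N (tau_invariant N V) r s n)"
    then obtain i j where "v = (Suc i, Suc j)" "j < s + n" "\<not> {i<..j} \<subseteq> tau_invariant N V"
      using cvars_generic_minor[OF assms(2,3), of "tau_invariant N V"] by blast
    then show "v \<in> {(s, t). (s, t - 1) \<in> pos_roots N - pos_roots_of N (tau_invariant N V)}"
      using root[of j i] assms(3) by simp
  qed
qed

lemma nonlinear_generator_cvars: "cvars f \<noteq> {}"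
proof
  assume "cvars f = {}"
  then obtain c where "f = cconst c" by (rule cvars_empty_imp_cconst)
  moreover have "f \<noteq> 0" "\<not> f dvd 1"
    using nonlinear_generatorD(2) unfolding irreducible_def by blast+
  ultimately show False using cconst_dvd_1[of c] cconst_eq_0_iff[of c] by blast
qed

end

section \<open>Scaling and uniqueness of the generator\<close>

lemma cvars_cconst_mult: "c \<noteq> 0 \<Longrightarrow> cvars (cconst c * f) = cvars f"
  by (simp add: cvars_def keys_cconst_mult)

lemma zero_in_S_n: "0 \<in> S_n N"
  by (simp add: S_n_def)

lemma S_n_add: "p \<in> S_n N \<Longrightarrow> q \<in> S_n N \<Longrightarrow> p + q \<in> S_n N"
  unfolding S_n_def using cvars_add by blast

lemma ideal_generated_mult_base:
  assumes "s \<in> S_n N" "a \<in> A"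
  shows "s * a \<in> ideal_generated N A"
  unfolding ideal_generated_def
  by (rule CollectI, rule exI[of _ "{a}"], rule exI[of _ "\<lambda>_. s"]) (use assms in auto)

lemma ideal_generated_add:
  assumes "p \<in> ideal_generated N A" "q \<in> ideal_generated N A"
  shows "p + q \<in> ideal_generated N A"
proof -
  from assms obtain F G c d where
    F: "finite F" "F \<subseteq> A" "\<forall>a\<in>F. c a \<in> S_n N" "p = (\<Sum>a\<in>F. c a * a)" and
    G: "finite G" "G \<subseteq> A" "\<forall>a\<in>G. d a \<in> S_n N" "q = (\<Sum>a\<in>G. d a * a)"
    unfolding ideal_generated_def by blast
  \<comment> \<open>\<open>F\<close> and \<open>G\<close> may overlap, so the coefficients are
    extended by 0 and added.\<close>
  define e where "e a = (if a \<in> F then c a else 0) + (if a \<in> G then d a else 0)" for a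
  have "p = (\<Sum>a\<in>F \<union> G. (if a \<in> F then c a else 0) * a)"
    unfolding F(4) using F G by (intro sum.mono_neutral_cong_left) auto
  moreover have "q = (\<Sum>a\<in>F \<union> G. (if a \<in> G then d a else 0) * a)"
    unfolding G(4) using F G by (intro sum.mono_neutral_cong_left) auto
  ultimately have "p + q = (\<Sum>a\<in>F \<union> G. e a * a)"
    unfolding e_def by (simp add: sum.distrib distrib_right)
  moreover have "e a \<in> S_n N" if "a \<in> F \<union> G" for a
    using F(3) G(3) that by (simp add: e_def zero_in_S_n S_n_add)
  ultimately show ?thesis
    unfolding ideal_generated_def using F G by blast
qed

lemma ideal_generated_insert_scaled_subset:
  assumes c: "c \<noteq> 0"
  shows "ideal_generated N (insert (cconst c * f) A) \<subseteq> ideal_generated N (insert f A)"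
proof
  fix p assume "p \<in> ideal_generated N (insert (cconst c * f) A)"
  then obtain F k where F: "finite F" "F \<subseteq> insert (cconst c * f) A" "\<forall>a\<in>F. k a \<in> S_n N"
    "p = (\<Sum>a\<in>F. k a * a)"
    unfolding ideal_generated_def by blast
  have base: "k a * a \<in> ideal_generated N (insert f A)" if a: "a \<in> F" for a
  proof (cases "a = cconst c * f")
    case True
    have "cconst c * k a \<in> S_n N" using F(3) a by (simp add: S_n_def cvars_cconst_mult[OF c])
    then have "(cconst c * k a) * f \<in> ideal_generated N (insert f A)"
      by (rule ideal_generated_mult_base) simp
    then show ?thesis using True by (simp add: mult_ac)
  next
    case False
    then show ?thesis using F a by (intro ideal_generated_mult_base) auto
  qed
  have zero: "0 \<in> ideal_generated N (insert f A)"
    using ideal_generated_mult_base[OF zero_in_S_n, of f "insert f A" N] by simp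
  have "(\<Sum>a\<in>G. k a * a) \<in> ideal_generated N (insert f A)" if "finite G" "G \<subseteq> F" for G
    using that by induction (auto simp: zero intro!: ideal_generated_add base)
  then show "p \<in> ideal_generated N (insert f A)" using F by simp
qed

lemma ideal_generated_insert_scaled:
  assumes c: "c \<noteq> 0"
  shows "ideal_generated N (insert (cconst c * f) A) = ideal_generated N (insert f A)"
proof -
  have inv: "cconst (1 / c) * (cconst c * f) = f"
    using c by (simp add: cconst_def mult_single single_one flip: mult.assoc)
  then show ?thesis
    using ideal_generated_insert_scaled_subset[OF c, of N f A]
      ideal_generated_insert_scaled_subset[of "1 / c" N "cconst c * f" A, unfolded inv] c
    by (intro equalityI) simp_all
qed

text \<open>Two generators divide each other, hence differ by a unit, and the units are the non-zero
  constants.\<close>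

lemma nonlinear_generator_unique:
  assumes V: "V \<subseteq> strict_upper N" and f: "nonlinear_generator N V f"
  shows "nonlinear_generator N V g \<longleftrightarrow> (\<exists>c. c \<noteq> 0 \<and> g = cconst c * f)"
proof
  assume g: "nonlinear_generator N V g"
  have "f dvd g"
    by (rule nonlinear_generator_dvd[OF V f nonlinear_generator_vanishes[OF V g] nonlinear_generatorD(1)[OF V g]])
  moreover have "g dvd f"
    by (rule nonlinear_generator_dvd[OF V g nonlinear_generator_vanishes[OF V f] nonlinear_generatorD(1)[OF V f]])
  ultimately obtain h k where h: "g = f * h" and k: "f = g * k" by (elim dvdE)
  have "f \<noteq> 0" using nonlinear_generator_cvars[OF V f] by auto
  moreover have "f * (h * k) = f * 1"
    by (simp only: mult.assoc[symmetric] h[symmetric] k[symmetric] mult_1_right)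
  ultimately have "h * k = 1" using mult_left_cancel by blast
  then obtain c where "c \<noteq> 0" "h = cconst c" by (rule unit_imp_cconst)
  then show "\<exists>c. c \<noteq> 0 \<and> g = cconst c * f" using h by (auto simp: mult.commute)
next
  assume "\<exists>c. c \<noteq> 0 \<and> g = cconst c * f"
  then obtain c where c: "c \<noteq> 0" and g: "g = cconst c * f" by blast
  show "nonlinear_generator N V g"
    using f unfolding nonlinear_generator_def Let_def g homogeneous_def keys_cconst_mult[OF c]
      cvars_cconst_mult[OF c] ideal_generated_insert_scaled[OF c]
      idom_class.irreducible_mult_unit_left[OF cconst_dvd_1[OF c]] .
qed

subsection \<open>The equation of the hypersurface\<close>

lemma length_le_of_part_eq_0:
  assumes "is_partition N \<mu>" "part \<mu> (I + 1) = 0"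
  shows "length \<mu> \<le> I"
proof (rule ccontr)
  assume "\<not> length \<mu> \<le> I"
  then have "\<mu> ! I \<in> set \<mu>" by simp
  moreover have "\<mu> ! I = 0" using assms(2) \<open>\<not> length \<mu> \<le> I\<close> by (simp add: part_def)
  ultimately show False using assms(1) by (simp add: is_partition_def)
qed

lemma l_number_eq:
  assumes "is_partition N \<mu>" "length \<mu> \<le> I"
  shows "l_number \<mu> I = N - I"
proof -
  have "(\<Sum>i = 1..I. part \<mu> i) = (\<Sum>i = 1..length \<mu>. part \<mu> i)"
    using assms(2) by (intro sum.mono_neutral_right) (auto simp: part_def)
  also have "\<dots> = (\<Sum>i = 0..<length \<mu>. \<mu> ! i)"
    by (rule sum.reindex_bij_witness[of _ Suc "\<lambda>i. i - 1"]) (auto simp: part_def)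
  also have "\<dots> = N" using assms(1) by (simp add: is_partition_def sum_list_sum_nth)
  finally show ?thesis by (simp add: l_number_def)
qed

lemma row_of_less:
  assumes "standard_tableau N T" "a \<in> {1..N}"
  shows "row_of T a < length T"
  using row_of_eq_iff[OF assms, of "row_of T a"] by simp

text \<open>These \<open>I\<close> roots would join the \<open>I + 1\<close> numbers
  \<open>i + 1\<close> to \<open>i + I + 1\<close>, whose boxes would need distinct rows.\<close>

lemma not_subset_tau_of_length_le:
  assumes V: "irreducible_set N V" "V \<subseteq> m_space N \<tau>" and T: "associated_tableau N V T"
    and len: "length T \<le> I" and i: "i + I < N"
  shows "\<not> {i<..i + I} \<subseteq> \<tau>"
proof
  assume "{i<..i + I} \<subseteq> \<tau>"
  then have "{i<..<Suc (i + I)} \<subseteq> \<tau>" by auto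
  then have "inj_on (row_of T) {i<..Suc (i + I)}"
    using inj_on_row_of_associated_tableau[OF V T, of i "Suc (i + I)"] i by simp
  moreover have "row_of T ` {i<..Suc (i + I)} \<subseteq> {..<length T}"
    using row_of_less[of N T] T i by (auto simp: associated_tableau_def)
  ultimately have "card {i<..Suc (i + I)} \<le> card {..<length T}"
    by (rule card_inj_on_le) simp
  then show False using len by simp
qed

text \<open>The chain occupies every row of the Richardson tableau, and distinct rows of \<open>T\<close>, so its
  largest element has to move from the last row to a new one.\<close>

lemma row_of_moved_box:
  assumes V: "irreducible_set N V" "V \<subseteq> m_space N \<tau>" "associated_tableau N V T"
    and W: "irreducible_set N W" "W \<subseteq> m_space N \<tau>" "associated_tableau N W S"
    and len: "length S \<le> a - b" and ab: "b < a" "a \<le> N" and \<tau>: "{b<..<a} \<subseteq> \<tau>"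
    and moved: "\<And>c. c \<in> {1..N} \<Longrightarrow> row_of T c = (if c = a then row_of S c + 1 else row_of S c)"
  shows "row_of T a = a - b"
proof -
  have S: "standard_tableau N S" using W(3) by (simp add: associated_tableau_def)
  have sub: "row_of S ` {b<..a} \<subseteq> {..<a - b}"
  proof
    fix r assume "r \<in> row_of S ` {b<..a}"
    then obtain c where "c \<in> {b<..a}" and r: "r = row_of S c" by (rule imageE)
    then have c: "c \<in> {1..N}" using ab by simp
    from r show "r \<in> {..<a - b}" using row_of_less[OF S c(1)] len by simp
  qed
  have "inj_on (row_of S) {b<..a}" by (rule inj_on_row_of_associated_tableau[OF W ab \<tau>])
  then have "card (row_of S ` {b<..a}) = card {..<a - b}" by (simp add: card_image)
  then have img: "row_of S ` {b<..a} = {..<a - b}" using sub by (intro card_subset_eq) auto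
  have injT: "inj_on (row_of T) {b<..a}" by (rule inj_on_row_of_associated_tableau[OF V ab \<tau>])
  have Ta: "row_of T a = row_of S a + 1" using moved[of a] ab by simp
  have "row_of S a \<in> row_of S ` {b<..a}" using ab by (intro imageI) simp
  then have "row_of S a < a - b" using sub by blast
  \<comment> \<open>Otherwise another element of the chain already occupies the next row and would
    share it with \<open>a\<close> in \<open>T\<close>.\<close>
  moreover have "\<not> row_of S a + 1 < a - b"
  proof
    assume "row_of S a + 1 < a - b"
    then have "row_of S a + 1 \<in> row_of S ` {b<..a}" unfolding img by simp
    then obtain c where c: "c \<in> {b<..a}" "row_of S c = row_of S a + 1" by auto
    then have "c \<noteq> a" by auto
    then have "row_of T c = row_of T a" using moved[of c] c ab Ta by simp
    then show False using injT c \<open>c \<noteq> a\<close> ab by (auto dest: inj_onD)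
  qed
  ultimately show ?thesis using Ta by simp
qed

lemma generic_minor_notin_vanishing_ideal:
  assumes W: "W \<subseteq> strict_upper N" "zariski_closure N W = m_space N \<tau>"
    and free: "\<And>i. i + I < N \<Longrightarrow> \<not> {i<..i + I} \<subseteq> \<tau>" and n: "I + n \<le> N"
  shows "generic_minor N \<tau> 0 I n \<notin> vanishing_ideal N W"
proof
  assume "generic_minor N \<tau> 0 I n \<in> vanishing_ideal N W"
  then have "generic_minor N \<tau> 0 I n \<in> vanishing_ideal N (m_space N \<tau>)"
    using vanishing_ideal_zariski_closure[OF W(1)] W(2) by simp
  moreover obtain x where "x \<in> m_space N \<tau>" "ceval x (generic_minor N \<tau> 0 I n) \<noteq> 0"
    using generic_minor_nonzero[of I N \<tau> 0 n, OF free] n by auto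
  ultimately show False by (simp add: vanishing_ideal_def)
qed

text \<open>The minor is not zero on the closure \<open>m_space\<close>, so it is not zero on
  \<open>W\<close>; at stage \<open>N\<close> all rows of the tableau are counted.\<close>

lemma length_le_of_dense:
  assumes W: "irreducible_set N W" "zariski_closure N W = m_space N \<tau>" "associated_tableau N W S"
    and free: "\<And>i. i + I < N \<Longrightarrow> \<not> {i<..i + I} \<subseteq> \<tau>" and I: "1 \<le> N" "I \<le> N"
  shows "length S \<le> I"
proof -
  have "W \<subseteq> m_space N \<tau>" using subset_zariski_closure[of W N] W(2) by simp
  moreover have "generic_minor N \<tau> 0 I (N - I) \<notin> vanishing_ideal N W"
    using W I by (intro generic_minor_notin_vanishing_ideal free) (auto simp: irreducible_set_def)
  ultimately have "card {r. r < length S \<and> 0 < row_length S N r} \<le> I"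
    using W I by (intro card_rows_le[where \<tau> = \<tau>]) auto
  moreover have "{r. r < length S \<and> 0 < row_length S N r} = {..<length S}"
    using row_length_full[of N S] W(3) by (auto simp: associated_tableau_def)
  ultimately show ?thesis by simp
qed

lemma cvars_subset_of_dvd:
  assumes "f dvd p" "p \<noteq> 0"
  shows "cvars f \<subseteq> cvars p"
proof -
  obtain g where g: "p = f * g" using assms(1) by (rule dvdE)
  then have "f \<noteq> 0" "g \<noteq> 0" using assms(2) by auto
  then show ?thesis using cvars_mult g by blast
qed

theorem proposition2:
  fixes N I :: nat and V VR :: "complex mat set" and TR :: "nat list list"
    and lam :: "nat list" and f :: cpoly
  assumes "hypersurface_orbital_variety N V"
    and "is_sigma_set N V (simple_roots N)"
    and "is_thickness N V I"
    and "richardson_orbital_variety N (tau_invariant N V) VR"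
    and "associated_tableau N VR TR"
    and "lam = shape TR"
    and "part lam (I + 1) = 0"
  shows "nonlinear_generator N V f \<longleftrightarrow>
    (\<exists>c. c \<noteq> 0 \<and> f = cconst c * minor_coeff N (tau_invariant N V) I (l_number lam I))"
proof -
  define \<tau> where "\<tau> = tau_invariant N V"
  have \<tau>: "\<tau> \<subseteq> simple_roots N" by (auto simp: \<tau>_def tau_invariant_def)
  have V: "irreducible_set N V"
    using assms(1) by (simp add: hypersurface_orbital_variety_def irreducible_set_orbital_variety)
  then have Vup: "V \<subseteq> strict_upper N" by (simp add: irreducible_set_def)
  \<comment> \<open>\<open>g\<close> is the generator behind the sigma-set. The arbitrary
    \<open>f\<close> of the claim is compared with it only at the end.\<close>
  obtain g where g: "nonlinear_generator N V g" and conn: "connected_roots N (simple_roots N)"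
    and min: "\<And>\<sigma>. connected_roots N \<sigma> \<Longrightarrow> g \<in> S_n_sub N \<sigma> \<Longrightarrow> simple_roots N \<subseteq> \<sigma>"
    using assms(2) unfolding is_sigma_set_def by blast
  have Vm: "V \<subseteq> m_space N \<tau>"
    unfolding \<tau>_def by (rule nonlinear_generator_subset_m_space[OF Vup g])
  obtain j0 i0 where j0: "(1, j0) \<in> cvars g" and i0: "(i0, N) \<in> cvars g"
    using connected_support_full[OF conn nonlinear_generator_in_S_n[OF Vup g]
        nonlinear_generator_cvars[OF Vup g] min] by blast
  have dvd: "g dvd generic_minor N \<tau> r s n"
    if "generic_minor N \<tau> r s n \<in> vanishing_ideal N V" "r + n \<le> N" "s + n \<le> N" for r s n
    using nonlinear_generator_dvd_generic_minor[OF Vup g] that unfolding \<tau>_def by blast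

  have VR: "irreducible_set N VR" "VR \<subseteq> m_space N \<tau>"
    using assms(4) subset_zariski_closure[of VR N] irreducible_set_orbital_variety
    by (auto simp: richardson_orbital_variety_def \<tau>_def)
  have partition: "is_partition N lam"
    using assms(5,6) by (simp add: associated_tableau_def standard_tableau_def)
  have "length TR \<le> I"
    using length_le_of_part_eq_0[OF partition assms(7)] assms(6) by (simp add: shape_def)
  then have free: "\<not> {i<..i + I} \<subseteq> \<tau>" if "i + I < N" for i
    using not_subset_tau_of_length_le[OF VR assms(5)] that by blast

  obtain WR S T C where WR: "richardson_orbital_variety N \<tau> WR" "associated_tableau N WR S"
    and T: "associated_tableau N V T" and C: "C \<in> chains N \<tau>" and IC: "I = card C"
    and moved: "\<forall>a \<in> {1..N}. row_of T a = (if a = Max C then row_of S a + 1 else row_of S a)"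
    using assms(3) unfolding is_thickness_def \<tau>_def by blast
  obtain a b where ab: "b < a" "a \<le> N" and Cab: "C = {b<..a}" and sub: "{b<..<a} \<subseteq> \<tau>"
    using chains_interval[OF C \<tau>] by blast
  have I: "I = a - b" using IC Cab by simp
  have "Max C = a" unfolding Cab using ab by (intro Max_eqI) auto
  note moved = moved[unfolded this]
  have W: "irreducible_set N WR" "zariski_closure N WR = m_space N \<tau>" "WR \<subseteq> m_space N \<tau>"
    using WR(1) subset_zariski_closure[of WR N] irreducible_set_orbital_variety
    by (auto simp: richardson_orbital_variety_def)
  \<comment> \<open>The thickness comes with its own Richardson variety and tableau, so the bound
    known for \<open>TR\<close> is carried over to \<open>S\<close> by means of
    \<open>free\<close>.\<close>
  have "length S \<le> I"
    by (rule length_le_of_dense[OF W(1,2) WR(2) free]) (use ab I in auto)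
  \<comment> \<open>Rows are numbered from 0, so this is a new row below the \<open>I\<close> rows
    of \<open>S\<close>.\<close>
  then have "row_of T a = I"
    using row_of_moved_box[OF V Vm T W(1,3) WR(2) _ ab sub] moved I by blast
  then have rows: "\<not> card {r. r < length T \<and> 0 < row_length T a r} \<le> I"
    using less_card_row_length[of N T a] T ab by (auto simp: associated_tableau_def)

  have "generic_minor N \<tau> 0 I (a - I) \<in> vanishing_ideal N V"
    using card_rows_le[OF V Vm T, of a I] rows ab I by fastforce
  then have "g dvd generic_minor N \<tau> 0 I (a - I)" by (rule dvd) (use ab I in auto)
  moreover have "generic_minor N \<tau> 0 I (a - I) \<noteq> 0"
    using generic_minor_neq_0[of I N \<tau> 0 "a - I", OF free] ab I by simp
  \<comment> \<open>This minor only involves the first \<open>a\<close> columns, whereas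
    \<open>g\<close> has a variable in column \<open>N\<close>.\<close>
  ultimately have "(i0, N) \<in> cvars (generic_minor N \<tau> 0 I (a - I))"
    using cvars_subset_of_dvd i0 by blast
  then have "N \<le> a" using cvars_generic_minor[of 0 "a - I" N I \<tau>] ab I by auto
  then have a: "a = N" using ab by simp
  let ?D = "generic_minor N \<tau> 0 I (N - I)"
  have D: "?D \<in> vanishing_ideal N V" "g dvd ?D"
    using \<open>generic_minor N \<tau> 0 I (a - I) \<in> _\<close> \<open>g dvd generic_minor N \<tau> 0 I (a - I)\<close> a by simp_all
  have IN: "I \<le> N" using I ab by simp

  \<comment> \<open>Such roots would join the \<open>I\<close> numbers from \<open>i + 2\<close> to
    \<open>i + I + 1\<close> and split the minor into diagonal blocks \<open>?D1\<close> and
    \<open>?D2\<close>. The first misses column \<open>N\<close> and the second misses row 1, but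
    \<open>g\<close> would divide one of them.\<close>
  have free': "\<not> {Suc i<..i + I} \<subseteq> \<tau>" if i: "Suc i + I < N" for i
  proof
    assume "{Suc i<..i + I} \<subseteq> \<tau>"
    then have sub: "{Suc i<..<I + Suc i} \<subseteq> \<tau>" by auto
    let ?D1 = "generic_minor N \<tau> 0 I (Suc i)"
      and ?D2 = "generic_minor N \<tau> (Suc i) (I + Suc i) (N - I - Suc i)"
    have prod: "ceval x ?D1 * ceval x ?D2 = 0" if "x \<in> V" for x
      using ceval_generic_minor_block[of x N \<tau> "Suc i" I "N - I"] sub that Vm D(1) i
      by (auto simp: vanishing_ideal_def)
    have "?D1 \<in> vanishing_ideal N V \<or> ?D2 \<in> vanishing_ideal N V"
      by (rule irreducible_set_vanishing_ideal_prime[OF V _ _ prod])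
        (use i in \<open>auto intro!: generic_minor_in_S_n\<close>)
    then show False
    proof
      assume "?D1 \<in> vanishing_ideal N V"
      then have "g dvd ?D1" by (rule dvd) (use i in auto)
      moreover have "?D1 \<noteq> 0" using generic_minor_neq_0[of I N \<tau> 0 "Suc i", OF free] i by simp
      ultimately have "(i0, N) \<in> cvars ?D1" using cvars_subset_of_dvd i0 by blast
      then show False using cvars_generic_minor[of 0 "Suc i" N I \<tau>] i by auto
    next
      assume "?D2 \<in> vanishing_ideal N V"
      then have "g dvd ?D2" by (rule dvd) (use i in auto)
      moreover have "?D2 \<noteq> 0"
        using generic_minor_neq_0[of I N \<tau> "Suc i" "N - I - Suc i", OF free] i by simp
      ultimately have mem: "(1, j0) \<in> cvars ?D2" using cvars_subset_of_dvd j0 by blast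
      have le: "Suc i + (N - I - Suc i) \<le> N" "I + Suc i + (N - I - Suc i) \<le> N"
        using i by simp_all
      from subsetD[OF cvars_generic_minor[OF le] mem] show False by simp
    qed
  qed

  obtain h where h: "?D = g * h" using D(2) by (rule dvdE)
  have "cvars h = {}"
    by (rule cvars_cofactor_generic_minor[OF IN h free free' j0])
  then obtain e where e: "h = cconst e" by (rule cvars_empty_imp_cconst)
  have "?D \<noteq> 0" using generic_minor_neq_0[of I N \<tau> 0 "N - I", OF free] IN by simp
  then have e0: "e \<noteq> 0" using h e by auto
  have De: "?D = cconst e * g" using h e by (simp add: mult.commute)
  \<comment> \<open>Being a non-zero constant multiple of \<open>g\<close>, the minor is itself a
    generator, so uniqueness can be applied relative to it.\<close>
  have "nonlinear_generator N V ?D"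
    using nonlinear_generator_unique[OF Vup g] De e0 by blast
  then have "nonlinear_generator N V f \<longleftrightarrow> (\<exists>c. c \<noteq> 0 \<and> f = cconst c * ?D)"
    by (rule nonlinear_generator_unique[OF Vup])
  moreover have "minor_coeff N \<tau> I (l_number lam I) = ?D"
    using l_number_eq[OF partition length_le_of_part_eq_0[OF partition assms(7)]]
      minor_coeff_eq_generic_minor[OF IN, of \<tau>] by simp
  ultimately show ?thesis unfolding \<tau>_def by simp
qed

end
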